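(* Let $C\subset\mathbb{R}^2$ be any open convex set which has two parallel supporting lines with positive curvature at their points of tangencies. Then, for every positive integer $m$, there exists an $m$-fold covering of the plane $\mathbb{R}^2$ with translates of $C$ that cannot be split into $2$ coverings.
   Context: A family $\mathcal{C}$ of subsets of $\mathbb{R}^d$ is an $m$-fold covering of a set $P\subseteq\mathbb{R}^d$ if every point of $P$ belongs to at least $m$ members of $\mathcal{C}$; a $1$-fold covering is called a covering. An $m$-fold covering $\mathcal{C}$ of $P$ can be split into $2$ coverings if $\mathcal{C}$ can be partitioned into two subfamilies, each of which is a covering of $P$. The two parallel supporting lines are distinct, with $C$ lying between them. The condition on the curvature means that the boundary of $C$ has a (finite) positive curvature at the point where each of the two supporting lines touches it: if the point of tangency is placed at the origin and the supporting line is taken as the $x$-axis with $C$ on the side $y>0$, then there is a constant $r>0$ such that for every $\delta>0$, in a sufficiently small neighborhood of the origin, the boundary of $C$ lies between the parabolas $y=(1-\delta)rx^2$ and $y=(1+\delta)rx^2$. *)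

theory Defs
  imports "HOL-Analysis.Analysis"
begin

(* A point may lie in infinitely many members, in which case card would be 0. *)
definition m_fold_covering :: "nat \<Rightarrow> 'a set set \<Rightarrow> 'a set \<Rightarrow> bool" where
  "m_fold_covering m F P \<longleftrightarrow>
     (\<forall>p\<in>P. infinite {S \<in> F. p \<in> S} \<or> m \<le> card {S \<in> F. p \<in> S})"

definition covering :: "'a set set \<Rightarrow> 'a set \<Rightarrow> bool" where
  "covering F P \<longleftrightarrow> m_fold_covering 1 F P"

definition splits_into_two_coverings :: "'a set set \<Rightarrow> 'a set \<Rightarrow> bool" where
  "splits_into_two_coverings F P \<longleftrightarrow>
     (\<exists>A B. A \<union> B = F \<and> A \<inter> B = {} \<and> covering A P \<and> covering B P)"

definition supporting_line :: "(real^2) set \<Rightarrow> (real^2) set \<Rightarrow> bool" where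
  "supporting_line C L \<longleftrightarrow>
     L \<inter> closure C \<noteq> {} \<and>
     (\<exists>n c. n \<noteq> 0 \<and> L = {x. n \<bullet> x = c} \<and> C \<subseteq> {x. c \<le> n \<bullet> x})"

(* In the orthonormal frame with origin p, x-axis L in direction e, and y-axis in the
   direction n pointing to the side of C, the point q has coordinates
   x = e \<bullet> (q - p) and y = n \<bullet> (q - p). *)
definition positive_curvature_at :: "(real^2) set \<Rightarrow> (real^2) set \<Rightarrow> real^2 \<Rightarrow> bool" where
  "positive_curvature_at C L p \<longleftrightarrow>
     p \<in> L \<inter> frontier C \<and>
     (\<exists>e n r. norm e = 1 \<and> norm n = 1 \<and> e \<bullet> n = 0 \<and>
        L = {x. n \<bullet> (x - p) = 0} \<and> C \<subseteq> {x. n \<bullet> (x - p) > 0} \<and>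
        r > 0 \<and>
        (\<forall>\<delta>>0. \<exists>\<epsilon>>0. \<forall>q \<in> frontier C \<inter> ball p \<epsilon>.
           (1 - \<delta>) * r * (e \<bullet> (q - p))\<^sup>2 \<le> n \<bullet> (q - p) \<and>
           n \<bullet> (q - p) \<le> (1 + \<delta>) * r * (e \<bullet> (q - p))\<^sup>2))"

(* The lines are supporting, parallel and distinct, so C necessarily lies between them:
   if C were on the same side of both, only one of them could meet its closure. *)
definition has_parallel_supporting_lines_with_positive_curvature :: "(real^2) set \<Rightarrow> bool" where
  "has_parallel_supporting_lines_with_positive_curvature C \<longleftrightarrow>
     (\<exists>L1 L2 p1 p2. supporting_line C L1 \<and> supporting_line C L2 \<and>
        affine_parallel L1 L2 \<and> L1 \<noteq> L2 \<and>
        positive_curvature_at C L1 p1 \<and> positive_curvature_at C L2 p2)"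

definition translates :: "(real^2) set \<Rightarrow> (real^2) set set" where
  "translates C = range (\<lambda>t. (+) t ` C)"

end

theory Submission
  imports Defs
begin

text \<open>A point \<open>x\<close> lies in the translate \<open>w + C\<close> exactly when \<open>w\<close> lies in \<open>x - C\<close>. A family of translates
of \<open>C\<close> is therefore a set \<open>W\<close> of points, and the points to be covered are the translates of
\<open>- C\<close>. The theorem asks for a set \<open>W\<close> such that every translate of \<open>- C\<close> contains at least \<open>m\<close>
points of \<open>W\<close>, while for every two-colouring of \<open>W\<close> some translate sees only one colour. In
coordinates adapted to the supporting lines, \<open>- C\<close> is, up to a translation, a convex set \<open>K\<close> that
touches the x-axis from above at the origin, with curvature \<open>\<alpha>\<close>, and touches a parallel line from
below at a point \<open>t\<close>, with curvature \<open>\<beta>\<close>.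

The combinatorial source is a recursively defined hypergraph with red edges of size at least \<open>k\<close>
and blue edges of size at least \<open>l\<close>: take the hypergraph for \<open>(k - 1, l)\<close>, the one for \<open>(k, l - 1)\<close>
and a new vertex \<open>p\<close>, and add \<open>p\<close> to all red edges of the first and to all blue edges of the second.
For every set \<open>S\<close> of vertices, some red edge lies in \<open>S\<close> or some blue edge misses \<open>S\<close>: if \<open>p \<in> S\<close>
look at the first half, otherwise at the second.

Its edges are realised by translates of \<open>K\<close>. Inside a window of width \<open>a\<close> and height \<open>a\<^sup>2\<close> around the
origin, a translate with its lowest point in the window looks, as \<open>a\<close> tends to 0, like the region
above a parabola of curvature \<open>\<alpha>\<close>, and a translate with its highest point there like the region
below a parabola of curvature \<open>\<beta>\<close>. The former become red edges and the latter blue ones. It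
suffices to find a finite configuration of points and parabolas with strict incidences
(\<open>config_exists\<close>). For the recursive step one half is shrunk towards \<open>(0, 0)\<close> and the other towards
\<open>(1, Y)\<close> with \<open>\<alpha> * \<beta> / (\<alpha> + \<beta>) < Y < min \<alpha> \<beta>\<close>. The upper bound keeps the edges of each half away
from the vertices of the other one; the lower bound leaves room for a point \<open>p\<close> above the red
parabola with apex \<open>(0, 0)\<close> and below the blue parabola with apex \<open>(1, Y)\<close>.

To reach the whole plane, add to the vertices all points outside the translates that serve as edges.
This keeps the family unsplittable, and a translate that sticks out of the union of the edges now
contains infinitely many points. Every other translate must contain all vertices of an edge. A translate placed high
above or far beside the red edges sticks out at its top, and one at an intermediate height is too
wide at the level of the window. The remaining case, at the scale of the window, is
\<open>poke_or_contain\<close>: if the top of \<open>q + K\<close> is covered by the tops of the red edges, then the apex of \<open>q\<close> lies below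
the upper hull of the red apexes, in the sense of parabolas of curvature \<open>\<beta>\<close>. Unless \<open>q\<close> is straight
below a red apex, and so contains that edge, the bottom of \<open>q + K\<close> then passes strictly below the
crossing point of two neighbouring red parabolas. Two properties that survive the recursion make this
work: the apexes are in convex position for both curvatures (\<open>spread\<close>), and the crossing points
of one colour avoid the edges of the other (\<open>apart\<close>). The blue side follows by point reflection.\<close>

section \<open>The parabola model\<close>

text \<open>The height of \<open>v\<close> above the parabola with apex \<open>q\<close> and signed curvature \<open>c\<close>. A red translate at \<open>q\<close>
contains \<open>v\<close> iff \<open>elevation \<alpha> q v > 0\<close>, a blue one iff \<open>elevation (-\<beta>) q v < 0\<close>.\<close>
definition elevation :: "real \<Rightarrow> real \<times> real \<Rightarrow> real \<times> real \<Rightarrow> real" where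
  "elevation c q v = snd v - snd q - c * (fst v - fst q)\<^sup>2"

text \<open>The anisotropic scaling that maps every parabola \<open>y = c * x\<^sup>2\<close> to itself.\<close>
definition zoom :: "real \<Rightarrow> real \<times> real \<Rightarrow> real \<times> real" where
  "zoom a v = (a * fst v, a\<^sup>2 * snd v)"

text \<open>The crossing point of the two parabolas of curvature \<open>c\<close> with apexes \<open>p\<close> and \<open>q\<close>; blue parabolas
have \<open>c = -\<beta>\<close>.\<close>
definition meet :: "real \<Rightarrow> real \<times> real \<Rightarrow> real \<times> real \<Rightarrow> real \<times> real" where
  "meet c p q =
     (let u = (fst p + fst q) / 2 + (snd q - snd p) / (2 * c * (fst q - fst p))
      in (u, snd p + c * (u - fst p)\<^sup>2))"

text \<open>The quotient \<open>double_area p q r / vandermonde p q r\<close> is the second divided difference of the heights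
at the three abscissas. Bounds on it are written in product form to avoid division.\<close>
definition double_area :: "real \<times> real \<Rightarrow> real \<times> real \<Rightarrow> real \<times> real \<Rightarrow> real" where
  "double_area p q r = snd p * (fst r - fst q) - snd q * (fst r - fst p) + snd r * (fst q - fst p)"

definition vandermonde :: "real \<times> real \<Rightarrow> real \<times> real \<Rightarrow> real \<times> real \<Rightarrow> real" where
  "vandermonde p q r = (fst q - fst p) * (fst r - fst q) * (fst r - fst p)"

text \<open>The divided difference of \<open>y - c * x\<^sup>2\<close> is that of \<open>y\<close> minus \<open>c\<close>. The two bounds thus say that the points
\<open>(x, y - \<beta> * x\<^sup>2)\<close> are in strictly concave position and the points \<open>(x, y + \<alpha> * x\<^sup>2)\<close> in strictly convex
position. Equivalently, each parabola of curvature \<open>- \<beta>\<close> with apex in the set appears on the upper envelope of these parabolas, and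
each one of curvature \<open>\<alpha>\<close> on the lower envelope, in the order of the abscissas. The same condition is
needed for the blue apexes, where the roles of the two envelopes are exchanged.\<close>
definition spread :: "real \<Rightarrow> real \<Rightarrow> (real \<times> real) set \<Rightarrow> bool" where
  "spread \<alpha> \<beta> Q \<longleftrightarrow> inj_on fst Q \<and>
     (\<forall>p\<in>Q. \<forall>q\<in>Q. \<forall>r\<in>Q. fst p < fst q \<and> fst q < fst r \<longrightarrow>
        - \<alpha> * vandermonde p q r < double_area p q r \<and> double_area p q r < \<beta> * vandermonde p q r)"

text \<open>The factor \<open>c\<close> carries the sign that unites both colours: for \<open>c = \<alpha>\<close> and \<open>d = -\<beta>\<close>, crossings of red
parabolas lie above all blue ones; for \<open>c = -\<beta>\<close> and \<open>d = \<alpha>\<close>, crossings of blue parabolas lie below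
all red ones.\<close>
definition apart :: "real \<Rightarrow> real \<Rightarrow> (real \<times> real) set \<Rightarrow> (real \<times> real) set \<Rightarrow> bool" where
  "apart c d P Q \<longleftrightarrow>
     (\<forall>p\<in>P. \<forall>q\<in>P. \<forall>j\<in>Q. fst p < fst q \<longrightarrow> 0 < c * elevation d j (meet c p q))"

text \<open>A realised hypergraph: vertices \<open>V\<close>, apexes \<open>R\<close> of the red and \<open>B\<close> of the blue edges. No vertex lies
on a parabola, so that the incidences survive small perturbations.\<close>
definition config :: "real \<Rightarrow> real \<Rightarrow> nat \<Rightarrow> nat \<Rightarrow>
    (real \<times> real) set \<Rightarrow> (real \<times> real) set \<Rightarrow> (real \<times> real) set \<Rightarrow> bool" where
  "config \<alpha> \<beta> k l V R B \<longleftrightarrow>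
     finite V \<and> finite R \<and> finite B \<and>
     spread \<alpha> \<beta> R \<and> spread \<alpha> \<beta> B \<and> apart \<alpha> (-\<beta>) R B \<and> apart (-\<beta>) \<alpha> B R \<and>
     (\<forall>q\<in>R. \<forall>v\<in>V. elevation \<alpha> q v \<noteq> 0) \<and> (\<forall>q\<in>B. \<forall>v\<in>V. elevation (-\<beta>) q v \<noteq> 0) \<and>
     (\<forall>q\<in>R. k \<le> card {v\<in>V. 0 < elevation \<alpha> q v}) \<and>
     (\<forall>q\<in>B. l \<le> card {v\<in>V. elevation (-\<beta>) q v < 0}) \<and>
     (\<forall>S. (\<exists>q\<in>R. \<forall>v\<in>V. 0 < elevation \<alpha> q v \<longrightarrow> v \<in> S) \<or>
          (\<exists>q\<in>B. \<forall>v\<in>V. elevation (-\<beta>) q v < 0 \<longrightarrow> v \<notin> S))"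

lemma configD:
  assumes "config \<alpha> \<beta> k l V R B"
  shows "finite V" "finite R" "finite B" "spread \<alpha> \<beta> R" "spread \<alpha> \<beta> B"
    "apart \<alpha> (-\<beta>) R B" "apart (-\<beta>) \<alpha> B R"
    "\<forall>q\<in>R. \<forall>v\<in>V. elevation \<alpha> q v \<noteq> 0" "\<forall>q\<in>B. \<forall>v\<in>V. elevation (-\<beta>) q v \<noteq> 0"
    "\<forall>q\<in>R. k \<le> card {v\<in>V. 0 < elevation \<alpha> q v}" "\<forall>q\<in>B. l \<le> card {v\<in>V. elevation (-\<beta>) q v < 0}"
    "(\<exists>q\<in>R. \<forall>v\<in>V. 0 < elevation \<alpha> q v \<longrightarrow> v \<in> S) \<or> (\<exists>q\<in>B. \<forall>v\<in>V. elevation (-\<beta>) q v < 0 \<longrightarrow> v \<notin> S)"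
  using assms unfolding config_def by simp_all

lemma elevation_zoom [simp]: "elevation c (zoom a q) (zoom a v) = a\<^sup>2 * elevation c q v"
  by (simp add: elevation_def zoom_def power2_eq_square algebra_simps)

lemma elevation_add [simp]: "elevation c (t + q) (t + v) = elevation c q v"
  by (simp add: elevation_def)

lemma meet_add: "meet c (t + p) (t + q) = t + meet c p q"
  by (simp add: meet_def Let_def prod_eq_iff add_divide_distrib)

lemma meet_zoom: assumes "a \<noteq> 0" shows "meet c (zoom a p) (zoom a q) = zoom a (meet c p q)"
proof -
  have u: "(a * fst p + a * fst q) / 2 + (a\<^sup>2 * snd q - a\<^sup>2 * snd p) / (2 * c * (a * fst q - a * fst p))
     = a * ((fst p + fst q) / 2 + (snd q - snd p) / (2 * c * (fst q - fst p)))" (is "?l = a * ?u")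
  proof -
    have "(a\<^sup>2 * snd q - a\<^sup>2 * snd p) / (2 * c * (a * fst q - a * fst p))
       = (a * (a * (snd q - snd p))) / (a * (2 * c * (fst q - fst p)))"
      by (simp add: power2_eq_square algebra_simps)
    also have "\<dots> = (a * (snd q - snd p)) / (2 * c * (fst q - fst p))" using assms by (rule mult_divide_mult_cancel_left)
    finally show ?thesis by (simp add: distrib_left distrib_right add_divide_distrib)
  qed
  have "a\<^sup>2 * snd p + c * (a * ?u - a * fst p)\<^sup>2 = a\<^sup>2 * (snd p + c * (?u - fst p)\<^sup>2)"
    by (simp add: power2_eq_square algebra_simps)
  then show ?thesis unfolding meet_def zoom_def Let_def fst_conv snd_conv u by simp
qed

lemma zoom_inj: "a \<noteq> 0 \<Longrightarrow> inj (zoom a)"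
  by (auto simp: inj_def zoom_def prod_eq_iff)

lemma double_area_add: "double_area (t + p) (t + q) (t + r) = double_area p q r"
  and vandermonde_add: "vandermonde (t + p) (t + q) (t + r) = vandermonde p q r"
  by (simp_all add: double_area_def vandermonde_def algebra_simps)

lemma double_area_zoom: "double_area (zoom a p) (zoom a q) (zoom a r) = a^3 * double_area p q r"
  and vandermonde_zoom: "vandermonde (zoom a p) (zoom a q) (zoom a r) = a^3 * vandermonde p q r"
  by (simp_all add: double_area_def vandermonde_def zoom_def algebra_simps power2_eq_square power3_eq_cube)

lemma tendsto_zoom [tendsto_intros]:
  assumes "(f \<longlongrightarrow> a) F" "(g \<longlongrightarrow> v) F"
  shows "((\<lambda>x. zoom (f x) (g x)) \<longlongrightarrow> zoom a v) F"
  unfolding zoom_def using assms by (intro tendsto_intros)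

lemma tendsto_elevation [tendsto_intros]:
  assumes "(f \<longlongrightarrow> p) F" "(g \<longlongrightarrow> v) F"
  shows "((\<lambda>x. elevation c (f x) (g x)) \<longlongrightarrow> elevation c p v) F"
  unfolding elevation_def using assms by (intro tendsto_intros)

lemma tendsto_meet [tendsto_intros]:
  assumes "(f \<longlongrightarrow> p) F" "(g \<longlongrightarrow> q) F" "c \<noteq> 0" "fst p \<noteq> fst q"
  shows "((\<lambda>x. meet c (f x) (g x)) \<longlongrightarrow> meet c p q) F"
  unfolding meet_def Let_def using assms by (intro tendsto_intros) auto

lemma zoom_0 [simp]: "zoom 0 v = 0"
  by (simp add: zoom_def zero_prod_def)

section \<open>The recursive construction\<close>

definition clusters :: "real \<Rightarrow> real \<times> real \<Rightarrow> (real \<times> real) set \<Rightarrow> (real \<times> real) set \<Rightarrow> (real \<times> real) set" where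
  "clusters a t P Q = zoom a ` P \<union> (\<lambda>v. t + zoom a v) ` Q"

lemma zoom_tendsto_origin: "((\<lambda>a. zoom a v) \<longlongrightarrow> 0) (at_right 0)"
proof -
  have "((\<lambda>a. zoom a v) \<longlongrightarrow> zoom 0 v) (at_right 0)" by (intro tendsto_intros)
  then show ?thesis by simp
qed

lemma zoom_tendsto_base: "((\<lambda>a. t + zoom a v) \<longlongrightarrow> t) (at_right 0)"
  using tendsto_add[OF tendsto_const zoom_tendsto_origin, of t] by simp

lemma eventually_at_right_pos: "eventually (\<lambda>a::real. 0 < a) (at_right 0)"
  by (rule eventually_at_right_less)

text \<open>As \<open>a\<close> tends to 0, the divided difference of a triple with members in both clusters tends to \<open>snd t\<close> if two
of its points are near the origin and to \<open>- snd t\<close> if two are near \<open>t\<close>. Triples inside one cluster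
keep their divided difference.\<close>
lemma spread_clusters:
  assumes fin: "finite P" "finite Q" and P: "spread \<alpha> \<beta> P" and Q: "spread \<alpha> \<beta> Q"
    and t: "fst t = 1" "\<bar>snd t\<bar> < \<alpha>" "\<bar>snd t\<bar> < \<beta>"
  shows "eventually (\<lambda>a. spread \<alpha> \<beta> (clusters a t P Q)) (at_right 0)"
proof -
  let ?E = "\<lambda>P. eventually P (at_right (0::real))"
  let ?ok = "\<lambda>p q r. - \<alpha> * vandermonde p q r < double_area p q r \<and> double_area p q r < \<beta> * vandermonde p q r"
  have *: "?E (\<lambda>a. fst (zoom a p) < fst (t + zoom a q))" for p q
  proof -
    have "((\<lambda>a. fst (t + zoom a q) - fst (zoom a p)) \<longlongrightarrow> fst t - fst (0::real\<times>real)) (at_right 0)"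
      by (intro tendsto_intros zoom_tendsto_origin zoom_tendsto_base)
    then have "?E (\<lambda>a. 0 < fst (t + zoom a q) - fst (zoom a p))"
      by (rule order_tendstoD(1)) (simp add: t)
    then show ?thesis by (rule eventually_mono) simp
  qed
  have sep: "?E (\<lambda>a. \<forall>p\<in>P. \<forall>q\<in>Q. fst (zoom a p) < fst (t + zoom a q))"
    using fin * by (simp add: eventually_ball_finite_distrib)
  \<comment> \<open>Both expressions vanish linearly in \<open>a\<close>; the limit is taken after dividing by \<open>a\<close>.\<close>
  have ppq0: "?E (\<lambda>a. ?ok (zoom a p) (zoom a q) (t + zoom a r))" if "fst p < fst q" for p q r
  proof -
    define A where "A = (\<lambda>a. a * snd p * (1 + a * fst r - a * fst q) - a * snd q * (1 + a * fst r - a * fst p)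
       + (snd t + a\<^sup>2 * snd r) * (fst q - fst p))"
    define W where "W = (\<lambda>a. (fst q - fst p) * (1 + a * fst r - a * fst q) * (1 + a * fst r - a * fst p))"
    have A: "double_area (zoom a p) (zoom a q) (t + zoom a r) = a * A a"
      and W: "vandermonde (zoom a p) (zoom a q) (t + zoom a r) = a * W a" for a
      by (simp_all add: double_area_def vandermonde_def zoom_def A_def W_def t algebra_simps power2_eq_square)
    have "(A \<longlongrightarrow> snd t * (fst q - fst p)) (at_right 0)" "(W \<longlongrightarrow> fst q - fst p) (at_right 0)"
      unfolding A_def W_def by (auto intro!: tendsto_eq_intros)
    then have "((\<lambda>a. A a + \<alpha> * W a) \<longlongrightarrow> (snd t + \<alpha>) * (fst q - fst p)) (at_right 0)"
      "((\<lambda>a. \<beta> * W a - A a) \<longlongrightarrow> (\<beta> - snd t) * (fst q - fst p)) (at_right 0)"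
      by (auto intro!: tendsto_eq_intros simp: algebra_simps)
    moreover have "0 < (snd t + \<alpha>) * (fst q - fst p)" "0 < (\<beta> - snd t) * (fst q - fst p)"
      using t that by auto
    ultimately have "?E (\<lambda>a. 0 < A a + \<alpha> * W a)" "?E (\<lambda>a. 0 < \<beta> * W a - A a)"
      by (auto dest: order_tendstoD(1))
    then show ?thesis using eventually_at_right_pos unfolding A W
    proof eventually_elim
      case (elim a)
      have "0 < a * (A a + \<alpha> * W a)" "0 < a * (\<beta> * W a - A a)" using elim by simp_all
      then show ?case by (simp add: algebra_simps)
    qed
  qed
  have pqq0: "?E (\<lambda>a. ?ok (zoom a p) (t + zoom a q) (t + zoom a r))" if "fst q < fst r" for p q r
  proof -
    define A where "A = (\<lambda>a. a\<^sup>2 * snd p * (fst r - fst q) - a * snd q * (1 + a * fst r - a * fst p)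
       + a * snd r * (1 + a * fst q - a * fst p) - snd t * (fst r - fst q))"
    define W where "W = (\<lambda>a. (fst r - fst q) * (1 + a * fst r - a * fst p) * (1 + a * fst q - a * fst p))"
    have A: "double_area (zoom a p) (t + zoom a q) (t + zoom a r) = a * A a"
      and W: "vandermonde (zoom a p) (t + zoom a q) (t + zoom a r) = a * W a" for a
      by (simp_all add: double_area_def vandermonde_def zoom_def A_def W_def t algebra_simps power2_eq_square)
    have "(A \<longlongrightarrow> - snd t * (fst r - fst q)) (at_right 0)" "(W \<longlongrightarrow> fst r - fst q) (at_right 0)"
      unfolding A_def W_def by (auto intro!: tendsto_eq_intros)
    then have "((\<lambda>a. A a + \<alpha> * W a) \<longlongrightarrow> (\<alpha> - snd t) * (fst r - fst q)) (at_right 0)"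
      "((\<lambda>a. \<beta> * W a - A a) \<longlongrightarrow> (\<beta> + snd t) * (fst r - fst q)) (at_right 0)"
      by (auto intro!: tendsto_eq_intros simp: algebra_simps)
    moreover have "0 < (\<alpha> - snd t) * (fst r - fst q)" "0 < (\<beta> + snd t) * (fst r - fst q)"
      using t that by auto
    ultimately have "?E (\<lambda>a. 0 < A a + \<alpha> * W a)" "?E (\<lambda>a. 0 < \<beta> * W a - A a)"
      by (auto dest: order_tendstoD(1))
    then show ?thesis using eventually_at_right_pos unfolding A W
    proof eventually_elim
      case (elim a)
      have "0 < a * (A a + \<alpha> * W a)" "0 < a * (\<beta> * W a - A a)" using elim by simp_all
      then show ?case by (simp add: algebra_simps)
    qed
  qed
  have ppq: "?E (\<lambda>a. \<forall>p\<in>P. \<forall>q\<in>P. \<forall>r\<in>Q. fst p < fst q \<longrightarrow> ?ok (zoom a p) (zoom a q) (t + zoom a r))"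
  proof (intro eventually_ball_finite ballI fin)
    fix p q r
    show "?E (\<lambda>a. fst p < fst q \<longrightarrow> ?ok (zoom a p) (zoom a q) (t + zoom a r))"
      by (cases "fst p < fst q") (simp_all only: ppq0 simp_thms eventually_True)
  qed
  have pqq: "?E (\<lambda>a. \<forall>p\<in>P. \<forall>q\<in>Q. \<forall>r\<in>Q. fst q < fst r \<longrightarrow> ?ok (zoom a p) (t + zoom a q) (t + zoom a r))"
  proof (intro eventually_ball_finite ballI fin)
    fix p q r
    show "?E (\<lambda>a. fst q < fst r \<longrightarrow> ?ok (zoom a p) (t + zoom a q) (t + zoom a r))"
      by (cases "fst q < fst r") (simp_all only: pqq0 simp_thms eventually_True)
  qed
  show ?thesis using sep ppq pqq eventually_at_right_pos
  proof eventually_elim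
    case (elim a)
    have mono: "fst (zoom a p) < fst (zoom a q) \<longleftrightarrow> fst p < fst q" for p q
      using elim(4) by (simp add: zoom_def)
    have scale: "?ok (zoom a p) (zoom a q) (zoom a r)" if "?ok p q r" for p q r
    proof -
      have "a^3 * (- \<alpha> * vandermonde p q r) < a^3 * double_area p q r" "a^3 * double_area p q r < a^3 * (\<beta> * vandermonde p q r)"
        using that elim(4) by (simp_all only: mult_less_cancel_left_pos zero_less_power)
      then show ?thesis by (simp add: double_area_zoom vandermonde_zoom mult_ac)
    qed
    have inj: "inj_on fst (clusters a t P Q)"
    proof (rule inj_onI)
      fix x y assume xy: "x \<in> clusters a t P Q" "y \<in> clusters a t P Q" "fst x = fst y"
      have z: "fst (zoom a p) = fst (zoom a q) \<longleftrightarrow> fst p = fst q" for p q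
        using elim(4) by (simp add: zoom_def)
      have iP: "inj_on fst P" and iQ: "inj_on fst Q" using P Q unfolding spread_def by auto
      have ne: "fst (zoom a p) \<noteq> fst (t + zoom a q)" if "p \<in> P" "q \<in> Q" for p q
        using elim(1) that by (auto dest: less_imp_neq)
      consider p q where "p \<in> P" "q \<in> P" "x = zoom a p" "y = zoom a q"
        | p q where "p \<in> P" "q \<in> Q" "x = zoom a p" "y = t + zoom a q"
        | p q where "p \<in> Q" "q \<in> P" "x = t + zoom a p" "y = zoom a q"
        | p q where "p \<in> Q" "q \<in> Q" "x = t + zoom a p" "y = t + zoom a q"
        using xy(1,2) unfolding clusters_def by blast
      then show "x = y"
      proof cases
        case 1 then show ?thesis using iP xy(3) z by (auto dest: inj_onD)
      next
        case 2 then show ?thesis using ne xy(3) by metis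
      next
        case 3 then show ?thesis using ne xy(3) by metis
      next
        case 4 then show ?thesis using iQ xy(3) z by (auto dest: inj_onD)
      qed
    qed
    have "?ok x y z" if x: "x \<in> clusters a t P Q" and y: "y \<in> clusters a t P Q"
      and z: "z \<in> clusters a t P Q" and xyz: "fst x < fst y" "fst y < fst z" for x y z
    proof -
      consider p q r where "p \<in> P" "q \<in> P" "r \<in> P" "x = zoom a p" "y = zoom a q" "z = zoom a r"
        | p q r where "p \<in> P" "q \<in> P" "r \<in> Q" "x = zoom a p" "y = zoom a q" "z = t + zoom a r"
        | p q r where "p \<in> P" "q \<in> Q" "r \<in> Q" "x = zoom a p" "y = t + zoom a q" "z = t + zoom a r"
        | p q r where "p \<in> Q" "q \<in> Q" "r \<in> Q" "x = t + zoom a p" "y = t + zoom a q" "z = t + zoom a r"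
      proof -
        have **: "(\<exists>p\<in>P. w = zoom a p) \<or> (\<exists>q\<in>Q. w = t + zoom a q)" if "w \<in> clusters a t P Q" for w
          using that unfolding clusters_def by blast
        have *: "\<exists>p\<in>P. w = zoom a p" if w: "w \<in> clusters a t P Q" "fst w < fst w'" and w': "\<exists>p\<in>P. w' = zoom a p" for w w'
          using **[OF w(1)]
        proof
          assume "\<exists>q\<in>Q. w = t + zoom a q"
          with w' elim(1) w(2) have False by (metis less_asym)
          then show ?thesis ..
        qed
        show thesis
        proof (cases "\<exists>p\<in>P. z = zoom a p")
          case True
          note y' = *[OF y xyz(2) True]
          note x' = *[OF x xyz(1) y']
          from True y' x' show thesis by (elim bexE) (rule that(1))
        next
          case z': False
          then have z'': "\<exists>q\<in>Q. z = t + zoom a q" using **[OF z] by blast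
          show thesis
          proof (cases "\<exists>p\<in>P. y = zoom a p")
            case True
            note x' = *[OF x xyz(1) True]
            from True x' z'' show thesis by (elim bexE) (rule that(2))
          next
            case False
            then have y'': "\<exists>q\<in>Q. y = t + zoom a q" using **[OF y] by blast
            from **[OF x] show thesis
            proof
              assume "\<exists>p\<in>P. x = zoom a p"
              with y'' z'' show thesis by (elim bexE) (rule that(3))
            next
              assume "\<exists>q\<in>Q. x = t + zoom a q"
              with y'' z'' show thesis by (elim bexE) (rule that(4))
            qed
          qed
        qed
      qed
      then show ?thesis
      proof cases
        case 1
        then have "?ok p q r" using P xyz mono unfolding spread_def by auto
        with 1 scale show ?thesis by simp
      next
        case 2
        then show ?thesis using elim(2) mono xyz by auto
      next
        case 3
        then show ?thesis using elim(3) mono xyz by auto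
      next
        case 4
        then have "?ok p q r" using Q xyz mono unfolding spread_def by auto
        with 4 scale show ?thesis by (simp add: double_area_add vandermonde_add)
      qed
    qed
    with inj show ?case unfolding spread_def by auto
  qed
qed

lemma ball_clusters: "(\<forall>x\<in>clusters a t P Q. \<phi> x) \<longleftrightarrow> (\<forall>p\<in>P. \<phi> (zoom a p)) \<and> (\<forall>q\<in>Q. \<phi> (t + zoom a q))"
  unfolding clusters_def by blast

text \<open>In the limit both clusters collapse, so only the crossing point of the two parabolas with apexes \<open>0\<close>
and \<open>t\<close>, and the points \<open>0\<close> and \<open>t\<close> themselves, have to be compared with the parabolas of the
other colour at \<open>0\<close> and at \<open>t\<close>. The crossing lies on the parabola \<open>y = c * x\<^sup>2\<close> away from its apex, hence
strictly on the correct side of \<open>y = d * x\<^sup>2\<close>, and similarly at \<open>t\<close>.\<close>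
lemma apart_clusters:
  assumes fin: "finite P1" "finite P2" "finite Q1" "finite Q2"
    and 1: "apart c d P1 Q1" and 2: "apart c d P2 Q2"
    and t: "fst t = 1" "\<bar>snd t\<bar> < \<bar>c\<bar>" "\<bar>snd t\<bar> < \<bar>d\<bar>" and cd: "c * d < 0"
  shows "eventually (\<lambda>a. apart c d (clusters a t P1 P2) (clusters a t Q1 Q2)) (at_right 0)"
proof -
  let ?E = "\<lambda>P. eventually P (at_right (0::real))"
  have c0: "c \<noteq> 0" using cd by auto
  have sep: "?E (\<lambda>a. \<forall>p\<in>P2. \<forall>q\<in>P1. \<not> fst (t + zoom a p) < fst (zoom a q))"
  proof (intro eventually_ball_finite ballI fin)
    fix p q
    have "((\<lambda>a. fst (t + zoom a p) - fst (zoom a q)) \<longlongrightarrow> fst t - fst (0::real\<times>real)) (at_right 0)"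
      by (intro tendsto_intros zoom_tendsto_origin zoom_tendsto_base)
    then have "?E (\<lambda>a. 0 < fst (t + zoom a p) - fst (zoom a q))"
      by (rule order_tendstoD(1)) (simp add: t)
    then show "?E (\<lambda>a. \<not> fst (t + zoom a p) < fst (zoom a q))" by (rule eventually_mono) simp
  qed
  have far: "?E (\<lambda>a. 0 < c * elevation d (f a) (g a))" if "(f \<longlongrightarrow> j) (at_right 0)"
    "(g \<longlongrightarrow> v) (at_right 0)" "0 < c * elevation d j v" for f g j v
    by (rule order_tendstoD(1)[OF _ that(3)]) (intro tendsto_intros that(1,2))
  define u where "u = 1/2 + snd t / (2 * c)"
  have u: "meet c 0 t = (u, c * u\<^sup>2)"
    by (simp add: meet_def Let_def t u_def)
  have "c + snd t \<noteq> 0" "snd t - c \<noteq> 0" using t by auto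
  then have u0: "u \<noteq> 0" "u \<noteq> 1" using c0 unfolding u_def by (auto simp: field_simps)
  have ccd: "0 < c * (c - d)"
    using cd by (simp add: right_diff_distrib) (metis less_trans zero_le_square le_less_linear leD order_less_le_trans)
  have tu: "c * u\<^sup>2 - snd t = c * (u - 1)\<^sup>2"
    using c0 unfolding u_def by (simp add: power2_eq_square field_simps)
  have m0: "0 < c * elevation d 0 (meet c 0 t)"
  proof -
    have "c * elevation d 0 (meet c 0 t) = c * (c - d) * u\<^sup>2" unfolding u by (simp add: elevation_def algebra_simps)
    also have "0 < \<dots>" using u0 by (intro mult_pos_pos[OF ccd]) simp
    finally show ?thesis .
  qed
  have mt: "0 < c * elevation d t (meet c 0 t)"
  proof -
    have "c * elevation d t (meet c 0 t) = c * (c - d) * (u - 1)\<^sup>2" unfolding u elevation_def fst_conv snd_conv tu t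
      by (simp add: algebra_simps)
    also have "0 < \<dots>" using u0 by (intro mult_pos_pos[OF ccd]) simp
    finally show ?thesis .
  qed
  have cs: "\<bar>c * snd t\<bar> < - (c * d)"
  proof -
    have "\<bar>c * snd t\<bar> < \<bar>c\<bar> * \<bar>d\<bar>" using t c0 by (simp add: abs_mult)
    also have "\<dots> = - (c * d)" using cd by (simp flip: abs_mult)
    finally show ?thesis .
  qed
  have z: "0 < c * elevation d t 0" "0 < c * elevation d 0 t"
    using cs by (simp_all add: elevation_def t algebra_simps)
  have h1: "?E (\<lambda>a. \<forall>p\<in>P1. \<forall>q\<in>P1. \<forall>j\<in>Q2. 0 < c * elevation d (t + zoom a j) (zoom a (meet c p q)))"
    by (intro eventually_ball_finite ballI fin far[OF zoom_tendsto_base zoom_tendsto_origin z(1)])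
  have h2: "?E (\<lambda>a. \<forall>p\<in>P2. \<forall>q\<in>P2. \<forall>j\<in>Q1. 0 < c * elevation d (zoom a j) (t + zoom a (meet c p q)))"
    by (intro eventually_ball_finite ballI fin far[OF zoom_tendsto_origin zoom_tendsto_base z(2)])
  have mm: "((\<lambda>a. meet c (zoom a p) (t + zoom a q)) \<longlongrightarrow> meet c 0 t) (at_right 0)" for p q
    by (intro tendsto_intros zoom_tendsto_origin zoom_tendsto_base) (simp_all add: c0 t)
  have h3: "?E (\<lambda>a. \<forall>p\<in>P1. \<forall>q\<in>P2. \<forall>j\<in>Q1. 0 < c * elevation d (zoom a j) (meet c (zoom a p) (t + zoom a q)))"
    by (intro eventually_ball_finite ballI fin far[OF zoom_tendsto_origin mm m0])
  have h4: "?E (\<lambda>a. \<forall>p\<in>P1. \<forall>q\<in>P2. \<forall>j\<in>Q2. 0 < c * elevation d (t + zoom a j) (meet c (zoom a p) (t + zoom a q)))"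
    by (intro eventually_ball_finite ballI fin far[OF zoom_tendsto_base mm mt])
  show ?thesis using sep h1 h2 h3 h4 eventually_at_right_pos
  proof eventually_elim
    case (elim a)
    have fz: "fst (zoom a p) < fst (zoom a q) \<longleftrightarrow> fst p < fst q" for p q
      using elim(6) by (simp add: zoom_def)
    have pos: "0 < c * (a\<^sup>2 * x) \<longleftrightarrow> 0 < c * x" for x
      using mult_less_cancel_left_pos[of "a\<^sup>2" 0 "c * x"] elim(6) mult.left_commute[of c "a\<^sup>2" x]
      by (simp only: mult_zero_right zero_less_power)
    have mz: "meet c (zoom a p) (zoom a q) = zoom a (meet c p q)" for p q
      by (rule meet_zoom) (use elim(6) in simp)
    show ?case
      using 1 2 elim(1-5) unfolding apart_def ball_clusters
      by (simp add: meet_add mz pos fz)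
  qed
qed

text \<open>The cluster with smaller red edges sits at the origin and that with smaller blue edges at \<open>t = (1, Y)\<close>;
the new vertex is \<open>p = (\<theta>, \<pi>)\<close>.\<close>
lemma config_step:
  assumes "0 < \<alpha>" "0 < \<beta>" and c1: "config \<alpha> \<beta> k (Suc l) V1 R1 B1" and c2: "config \<alpha> \<beta> (Suc k) l V2 R2 B2"
  shows "\<exists>V R B. config \<alpha> \<beta> (Suc k) (Suc l) V R B"
proof -
  let ?E = "\<lambda>P. eventually P (at_right (0::real))"
  \<comment> \<open>The abscissa \<open>\<theta>\<close> minimises \<open>\<alpha> * \<theta>\<^sup>2 + \<beta> * (1 - \<theta>)\<^sup>2\<close>, the infimum of the \<open>Y\<close> for which a point fits above the one parabola and below the other.\<close>
  define \<theta> where "\<theta> = \<beta> / (\<alpha> + \<beta>)"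
  have \<theta>: "1 - \<theta> = \<alpha> / (\<alpha> + \<beta>)" using assms(1,2) by (simp add: \<theta>_def field_simps)
  have "\<alpha> * \<theta>\<^sup>2 + \<beta> * (1 - \<theta>)\<^sup>2 = \<alpha> * \<beta> / (\<alpha> + \<beta>)"
  proof -
    have "\<alpha> * \<theta>\<^sup>2 + \<beta> * (1 - \<theta>)\<^sup>2 = (\<alpha> * \<beta>\<^sup>2 + \<beta> * \<alpha>\<^sup>2) / (\<alpha> + \<beta>)\<^sup>2"
      unfolding \<theta> unfolding \<theta>_def by (simp add: power_divide add_divide_distrib)
    also have "\<alpha> * \<beta>\<^sup>2 + \<beta> * \<alpha>\<^sup>2 = (\<alpha> * \<beta>) * (\<alpha> + \<beta>)" by (simp add: power2_eq_square algebra_simps)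
    finally show ?thesis using assms(1,2) by (simp add: power2_eq_square)
  qed
  also have "\<dots> < min \<alpha> \<beta>" using assms(1,2) by (simp add: field_simps)
  finally obtain Y where Y: "\<alpha> * \<theta>\<^sup>2 + \<beta> * (1 - \<theta>)\<^sup>2 < Y" "Y < min \<alpha> \<beta>"
    using dense by blast
  then obtain \<pi> where \<pi>: "\<alpha> * \<theta>\<^sup>2 < \<pi>" "\<pi> < Y - \<beta> * (1 - \<theta>)\<^sup>2"
    using dense[of "\<alpha> * \<theta>\<^sup>2" "Y - \<beta> * (1 - \<theta>)\<^sup>2"] by auto
  define t where "t = (1::real, Y)"
  define p where "p = (\<theta>, \<pi>)"
  have sq: "0 \<le> \<alpha> * \<theta>\<^sup>2" "0 \<le> \<beta> * (1 - \<theta>)\<^sup>2" "0 \<le> \<beta> * \<theta>\<^sup>2" using assms(1,2) by simp_all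
  then have Y0: "0 < Y" using Y \<pi> by linarith
  have "0 \<le> \<alpha> * (1 - \<theta>)\<^sup>2" using assms(1) by simp
  then have sq': "\<pi> - Y < \<alpha> * (1 - \<theta>)\<^sup>2" "0 < \<pi> + \<beta> * \<theta>\<^sup>2" using \<pi> sq by linarith+
  have t: "fst t = 1" "\<bar>snd t\<bar> < \<alpha>" "\<bar>snd t\<bar> < \<beta>" using Y Y0 by (simp_all add: t_def)
  have fin: "finite V1" "finite R1" "finite B1" "finite V2" "finite R2" "finite B2"
    using c1 c2 by (simp_all add: configD)
  have "0 < elevation \<alpha> 0 p" "elevation \<alpha> 0 t < 0" "elevation \<alpha> t p < 0" "elevation \<alpha> t 0 < 0"
    "0 < elevation (-\<beta>) 0 p" "0 < elevation (-\<beta>) 0 t" "elevation (-\<beta>) t p < 0" "0 < elevation (-\<beta>) t 0"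
    using t \<pi> Y Y0 sq' unfolding elevation_def p_def t_def by (simp_all add: power2_commute[of \<theta> 1])
  note z = this
  have neg: "?E (\<lambda>a. elevation c (f a) (g a) < 0)" if "(f \<longlongrightarrow> j) (at_right 0)"
    "(g \<longlongrightarrow> v) (at_right 0)" "elevation c j v < 0" for f g j v c
    by (rule order_tendstoD(2)[OF _ that(3)]) (intro tendsto_intros that(1,2))
  have pos: "?E (\<lambda>a. 0 < elevation c (f a) (g a))" if "(f \<longlongrightarrow> j) (at_right 0)"
    "(g \<longlongrightarrow> v) (at_right 0)" "0 < elevation c j v" for f g j v c
    by (rule order_tendstoD(1)[OF _ that(3)]) (intro tendsto_intros that(1,2))
  note ev = eventually_ball_finite fin ballI
  have r1: "?E (\<lambda>a. \<forall>q\<in>R1. 0 < elevation \<alpha> (zoom a q) p)" by (intro ev pos[OF zoom_tendsto_origin tendsto_const z(1)])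
  have r2: "?E (\<lambda>a. \<forall>q\<in>R1. \<forall>v\<in>V2. elevation \<alpha> (zoom a q) (t + zoom a v) < 0)" by (intro ev neg[OF zoom_tendsto_origin zoom_tendsto_base z(2)])
  have r3: "?E (\<lambda>a. \<forall>q\<in>R2. elevation \<alpha> (t + zoom a q) p < 0)" by (intro ev neg[OF zoom_tendsto_base tendsto_const z(3)])
  have r4: "?E (\<lambda>a. \<forall>q\<in>R2. \<forall>v\<in>V1. elevation \<alpha> (t + zoom a q) (zoom a v) < 0)" by (intro ev neg[OF zoom_tendsto_base zoom_tendsto_origin z(4)])
  have b1: "?E (\<lambda>a. \<forall>q\<in>B1. 0 < elevation (-\<beta>) (zoom a q) p)" by (intro ev pos[OF zoom_tendsto_origin tendsto_const z(5)])
  have b2: "?E (\<lambda>a. \<forall>q\<in>B1. \<forall>v\<in>V2. 0 < elevation (-\<beta>) (zoom a q) (t + zoom a v))" by (intro ev pos[OF zoom_tendsto_origin zoom_tendsto_base z(6)])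
  have b3: "?E (\<lambda>a. \<forall>q\<in>B2. elevation (-\<beta>) (t + zoom a q) p < 0)" by (intro ev neg[OF zoom_tendsto_base tendsto_const z(7)])
  have b4: "?E (\<lambda>a. \<forall>q\<in>B2. \<forall>v\<in>V1. 0 < elevation (-\<beta>) (t + zoom a q) (zoom a v))" by (intro ev pos[OF zoom_tendsto_base zoom_tendsto_origin z(8)])
  have sR: "?E (\<lambda>a. spread \<alpha> \<beta> (clusters a t R1 R2))" and sB: "?E (\<lambda>a. spread \<alpha> \<beta> (clusters a t B1 B2))"
    by (intro spread_clusters fin configD[OF c1] configD[OF c2] t)+
  have aR: "?E (\<lambda>a. apart \<alpha> (-\<beta>) (clusters a t R1 R2) (clusters a t B1 B2))"
    and aB: "?E (\<lambda>a. apart (-\<beta>) \<alpha> (clusters a t B1 B2) (clusters a t R1 R2))"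
    by ((rule apart_clusters, intro fin, intro fin, intro fin, intro fin, intro configD[OF c1], intro configD[OF c2]); use t assms(1,2) in simp)+
  have np: "?E (\<lambda>a. \<forall>v\<in>V1. zoom a v \<noteq> p)" "?E (\<lambda>a. \<forall>v\<in>V2. t + zoom a v \<noteq> p)"
  proof -
    have "p \<noteq> 0" "p \<noteq> t" using z by (auto simp: elevation_def)
    then show "?E (\<lambda>a. \<forall>v\<in>V1. zoom a v \<noteq> p)" "?E (\<lambda>a. \<forall>v\<in>V2. t + zoom a v \<noteq> p)"
      by (intro ev; metis tendsto_imp_eventually_ne zoom_tendsto_origin zoom_tendsto_base)+
  qed
  have "?E (\<lambda>a. \<exists>V R B. config \<alpha> \<beta> (Suc k) (Suc l) V R B)"
    using r1 r2 r3 r4 b1 b2 b3 b4 sR sB aR aB np eventually_at_right_pos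
  proof eventually_elim
    case (elim a)
    let ?V = "insert p (clusters a t V1 V2)" and ?R = "clusters a t R1 R2" and ?B = "clusters a t B1 B2"
    have a2: "0 < a\<^sup>2" using elim by simp
    have sgn: "0 < a\<^sup>2 * x \<longleftrightarrow> 0 < x" "a\<^sup>2 * x < 0 \<longleftrightarrow> x < 0" for x
      using mult_less_cancel_left_pos[OF a2, of 0 x] mult_less_cancel_left_pos[OF a2, of x 0]
      by (simp_all only: mult_zero_right)
    have inj: "inj_on (zoom a) A" "inj_on (\<lambda>v. t + zoom a v) A" for A
      using zoom_inj[of a] elim by (auto simp: inj_on_def)
    have cardR1: "Suc k \<le> card {v\<in>?V. 0 < elevation \<alpha> (zoom a q) v}" if "q \<in> R1" for q
    proof -
      have "k \<le> card {v\<in>V1. 0 < elevation \<alpha> q v}" using configD(10)[OF c1] that by blast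
      then have "Suc k \<le> card (insert p (zoom a ` {v\<in>V1. 0 < elevation \<alpha> q v}))"
        using elim(13) fin by (subst card_insert_disjoint) (auto simp: card_image inj)
      also have "\<dots> \<le> card {v\<in>?V. 0 < elevation \<alpha> (zoom a q) v}"
        using fin elim(1) that by (intro card_mono) (auto simp: clusters_def sgn)
      finally show ?thesis .
    qed
    have cardR2: "Suc k \<le> card {v\<in>?V. 0 < elevation \<alpha> (t + zoom a q) v}" if "q \<in> R2" for q
    proof -
      have "Suc k \<le> card {v\<in>V2. 0 < elevation \<alpha> q v}" using configD(10)[OF c2] that by blast
      also have "\<dots> = card ((\<lambda>v. t + zoom a v) ` {v\<in>V2. 0 < elevation \<alpha> q v})" by (simp add: card_image inj)
      also have "\<dots> \<le> card {v\<in>?V. 0 < elevation \<alpha> (t + zoom a q) v}"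
        using fin that by (intro card_mono) (auto simp: clusters_def sgn)
      finally show ?thesis .
    qed
    have cardB1: "Suc l \<le> card {v\<in>?V. elevation (-\<beta>) (zoom a q) v < 0}" if "q \<in> B1" for q
    proof -
      have "Suc l \<le> card {v\<in>V1. elevation (-\<beta>) q v < 0}" using configD(11)[OF c1] that by blast
      also have "\<dots> = card (zoom a ` {v\<in>V1. elevation (-\<beta>) q v < 0})" by (simp add: card_image inj)
      also have "\<dots> \<le> card {v\<in>?V. elevation (-\<beta>) (zoom a q) v < 0}"
        using fin that by (intro card_mono) (auto simp: clusters_def sgn)
      finally show ?thesis .
    qed
    have cardB2: "Suc l \<le> card {v\<in>?V. elevation (-\<beta>) (t + zoom a q) v < 0}" if "q \<in> B2" for q
    proof -
      have "l \<le> card {v\<in>V2. elevation (-\<beta>) q v < 0}" using configD(11)[OF c2] that by blast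
      then have "Suc l \<le> card (insert p ((\<lambda>v. t + zoom a v) ` {v\<in>V2. elevation (-\<beta>) q v < 0}))"
        using elim(14) fin by (subst card_insert_disjoint) (auto simp: card_image inj)
      also have "\<dots> \<le> card {v\<in>?V. elevation (-\<beta>) (t + zoom a q) v < 0}"
        using fin elim(7) that by (intro card_mono) (auto simp: clusters_def sgn)
      finally show ?thesis .
    qed
    have colour: "(\<exists>q\<in>?R. \<forall>v\<in>?V. 0 < elevation \<alpha> q v \<longrightarrow> v \<in> S) \<or> (\<exists>q\<in>?B. \<forall>v\<in>?V. elevation (-\<beta>) q v < 0 \<longrightarrow> v \<notin> S)" for S
    proof (cases "p \<in> S")
      case True
      have "(\<exists>q\<in>R1. \<forall>v\<in>V1. 0 < elevation \<alpha> q v \<longrightarrow> v \<in> zoom a -` S) \<or> (\<exists>q\<in>B1. \<forall>v\<in>V1. elevation (-\<beta>) q v < 0 \<longrightarrow> v \<notin> zoom a -` S)"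
        by (rule configD(12)[OF c1])
      then show ?thesis
      proof (elim disjE bexE)
        fix q assume q: "q \<in> R1" "\<forall>v\<in>V1. 0 < elevation \<alpha> q v \<longrightarrow> v \<in> zoom a -` S"
        have n: "\<not> 0 < elevation \<alpha> (zoom a q) (t + zoom a v)" if "v \<in> V2" for v using elim(2) q(1) that by (meson less_asym)
        have "\<forall>v\<in>?V. 0 < elevation \<alpha> (zoom a q) v \<longrightarrow> v \<in> S"
          unfolding ball_simps ball_clusters using q(2) True by (simp add: sgn n)
        then show ?thesis using q(1) unfolding clusters_def by blast
      next
        fix q assume q: "q \<in> B1" "\<forall>v\<in>V1. elevation (-\<beta>) q v < 0 \<longrightarrow> v \<notin> zoom a -` S"
        have n: "\<not> elevation (-\<beta>) (zoom a q) (t + zoom a v) < 0" if "v \<in> V2" for v using elim(6) q(1) that by (meson less_asym)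
        have np: "\<not> elevation (-\<beta>) (zoom a q) p < 0" using elim(5) q(1) by (meson less_asym)
        have "\<forall>v\<in>?V. elevation (-\<beta>) (zoom a q) v < 0 \<longrightarrow> v \<notin> S"
          unfolding ball_simps ball_clusters using q(2) by (simp add: sgn n np)
        then show ?thesis using q(1) unfolding clusters_def by blast
      qed
    next
      case False
      have "(\<exists>q\<in>R2. \<forall>v\<in>V2. 0 < elevation \<alpha> q v \<longrightarrow> v \<in> (\<lambda>v. t + zoom a v) -` S) \<or> (\<exists>q\<in>B2. \<forall>v\<in>V2. elevation (-\<beta>) q v < 0 \<longrightarrow> v \<notin> (\<lambda>v. t + zoom a v) -` S)"
        by (rule configD(12)[OF c2])
      then show ?thesis
      proof (elim disjE bexE)
        fix q assume q: "q \<in> R2" "\<forall>v\<in>V2. 0 < elevation \<alpha> q v \<longrightarrow> v \<in> (\<lambda>v. t + zoom a v) -` S"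
        have n: "\<not> 0 < elevation \<alpha> (t + zoom a q) (zoom a v)" if "v \<in> V1" for v using elim(4) q(1) that by (meson less_asym)
        have np: "\<not> 0 < elevation \<alpha> (t + zoom a q) p" using elim(3) q(1) by (meson less_asym)
        have "\<forall>v\<in>?V. 0 < elevation \<alpha> (t + zoom a q) v \<longrightarrow> v \<in> S"
          unfolding ball_simps ball_clusters using q(2) by (simp add: sgn n np)
        then show ?thesis using q(1) unfolding clusters_def by blast
      next
        fix q assume q: "q \<in> B2" "\<forall>v\<in>V2. elevation (-\<beta>) q v < 0 \<longrightarrow> v \<notin> (\<lambda>v. t + zoom a v) -` S"
        have n: "\<not> elevation (-\<beta>) (t + zoom a q) (zoom a v) < 0" if "v \<in> V1" for v using elim(8) q(1) that by (meson less_asym)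
        have "\<forall>v\<in>?V. elevation (-\<beta>) (t + zoom a q) v < 0 \<longrightarrow> v \<notin> S"
          unfolding ball_simps ball_clusters using q(2) False by (simp add: sgn n)
        then show ?thesis using q(1) unfolding clusters_def by blast
      qed
    qed
    have n1: "\<forall>q\<in>R1. \<forall>v\<in>V1. elevation \<alpha> q v \<noteq> 0" "\<forall>q\<in>R2. \<forall>v\<in>V2. elevation \<alpha> q v \<noteq> 0"
      "\<forall>q\<in>B1. \<forall>v\<in>V1. elevation (-\<beta>) q v \<noteq> 0" "\<forall>q\<in>B2. \<forall>v\<in>V2. elevation (-\<beta>) q v \<noteq> 0"
      using configD(8,9)[OF c1] configD(8,9)[OF c2] by simp_all
    have nR: "\<forall>q\<in>?R. \<forall>v\<in>?V. elevation \<alpha> q v \<noteq> 0"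
      using n1 elim(1-4) a2 unfolding ball_clusters ball_simps by (simp add: less_imp_neq less_imp_neq[THEN not_sym])
    have nB: "\<forall>q\<in>?B. \<forall>v\<in>?V. elevation (-\<beta>) q v \<noteq> 0"
      using n1 elim(5-8) a2 unfolding ball_clusters ball_simps by (simp add: less_imp_neq less_imp_neq[THEN not_sym])
    have "config \<alpha> \<beta> (Suc k) (Suc l) ?V ?R ?B"
      unfolding config_def
      using elim(9-12) nR nB colour cardR1 cardR2 cardB1 cardB2
      by (simp only: ball_clusters) (auto simp: clusters_def fin)
    then show ?case by blast
  qed
  then show ?thesis by (simp add: trivial_limit_at_right_real)
qed

text \<open>The recursion bottoms out at \<open>k = 0\<close> or \<open>l = 0\<close>, where an empty edge of the respective colour is
contained in every set and disjoint from every set.\<close>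
lemma config_exists:
  assumes "0 < \<alpha>" "0 < \<beta>"
  shows "\<exists>V R B. config \<alpha> \<beta> k l V R B"
proof (induction k arbitrary: l)
  case 0
  have "config \<alpha> \<beta> 0 l {} {0} {}" by (simp add: config_def spread_def apart_def)
  then show ?case by blast
next
  case (Suc k)
  note outer = this
  show ?case
  proof (induction l)
    case 0
    have "config \<alpha> \<beta> (Suc k) 0 {} {} {0}" by (simp add: config_def spread_def apart_def)
    then show ?case by blast
  next
    case (Suc l)
    with outer[of "Suc l"] show ?case using config_step[OF assms] by blast
  qed
qed

section \<open>Point reflection\<close>

text \<open>Point reflection exchanges the two colours and the two curvatures; the lemmas of this section transport the
invariants, so that later arguments need only be carried out for red.\<close>
lemma elevation_minus [simp]: "elevation c (- q) (- v) = - elevation (- c) q v"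
  by (simp add: elevation_def power2_eq_square algebra_simps)

lemma meet_commute:
  assumes "fst p \<noteq> fst q" "c \<noteq> 0" shows "meet c p q = meet c q p"
proof -
  define u where "u = (fst p + fst q) / 2 + (snd q - snd p) / (2 * c * (fst q - fst p))"
  have u: "u = (fst q + fst p) / 2 + (snd p - snd q) / (2 * c * (fst p - fst q))"
    unfolding u_def using assms by (simp add: field_simps)
  have "c * (fst q - fst p) * (2 * u - fst p - fst q) = snd q - snd p"
    unfolding u_def using assms by (simp add: field_simps)
  then have "snd p + c * (u - fst p)\<^sup>2 = snd q + c * (u - fst q)\<^sup>2"
    by (simp add: power2_eq_square algebra_simps)
  then show ?thesis unfolding meet_def Let_def u_def[symmetric] u[symmetric] by simp
qed

lemma meet_minus: "meet c (- p) (- q) = - meet (- c) p q"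
proof -
  define u where "u = (fst p + fst q) / 2 + (snd q - snd p) / (2 * (- c) * (fst q - fst p))"
  have u: "(fst (- p) + fst (- q)) / 2 + (snd (- q) - snd (- p)) / (2 * c * (fst (- q) - fst (- p))) = - u"
  proof -
    define d where "d = 2 * c * (fst q - fst p)"
    have d: "2 * c * (fst (- q) - fst (- p)) = - d" "2 * (- c) * (fst q - fst p) = - d"
      and s: "snd (- q) - snd (- p) = - (snd q - snd p)" "fst (- p) + fst (- q) = - (fst p + fst q)"
      by (simp_all add: d_def algebra_simps)
    show ?thesis unfolding u_def d s by (simp add: diff_divide_distrib add_divide_distrib)
  qed
  show ?thesis unfolding meet_def Let_def u u_def[symmetric]
    by (simp add: prod_eq_iff power2_eq_square algebra_simps)
qed

lemma double_area_minus: "double_area (- r) (- q) (- p) = - double_area p q r"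
  and vandermonde_minus: "vandermonde (- r) (- q) (- p) = vandermonde p q r"
  by (simp_all add: double_area_def vandermonde_def algebra_simps)

lemma spread_minus: "spread \<alpha> \<beta> Q \<Longrightarrow> spread \<beta> \<alpha> (uminus ` Q)"
proof -
  assume Q: "spread \<alpha> \<beta> Q"
  have "inj_on fst (uminus ` Q)" using Q unfolding spread_def inj_on_def by simp
  moreover have "- \<beta> * vandermonde (- p) (- q) (- r) < double_area (- p) (- q) (- r) \<and> double_area (- p) (- q) (- r) < \<alpha> * vandermonde (- p) (- q) (- r)"
    if "p \<in> Q" "q \<in> Q" "r \<in> Q" "fst (- p) < fst (- q)" "fst (- q) < fst (- r)" for p q r
  proof -
    have "- \<alpha> * vandermonde r q p < double_area r q p \<and> double_area r q p < \<beta> * vandermonde r q p"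
      using Q that unfolding spread_def by auto
    then show ?thesis unfolding double_area_minus[of p q r] vandermonde_minus[of p q r] by linarith
  qed
  ultimately show ?thesis unfolding spread_def ball_simps(9) by blast
qed

lemma apart_minus: "apart c d P Q \<Longrightarrow> c \<noteq> 0 \<Longrightarrow> apart (- c) (- d) (uminus ` P) (uminus ` Q)"
  unfolding apart_def ball_simps(9)
proof (intro ballI impI)
  fix p q j
  assume *: "\<forall>p\<in>P. \<forall>q\<in>P. \<forall>j\<in>Q. fst p < fst q \<longrightarrow> 0 < c * elevation d j (meet c p q)" "c \<noteq> 0"
    "p \<in> P" "q \<in> P" "j \<in> Q" "fst (- p) < fst (- q)"
  then have "0 < c * elevation d j (meet c q p)" by simp
  also have "meet c q p = meet c p q" using * by (intro meet_commute) auto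
  finally show "0 < - c * elevation (- d) (- j) (meet (- c) (- p) (- q))" by (simp add: meet_minus)
qed

section \<open>Translates at the scale of the window\<close>

lemma finite_sets_between:
  fixes A B :: "real set"
  assumes "finite A" "finite B" "\<And>a b. a \<in> A \<Longrightarrow> b \<in> B \<Longrightarrow> a < b"
  shows "\<exists>z. (\<forall>a\<in>A. a < z) \<and> (\<forall>b\<in>B. z < b)"
proof (cases "A = {} \<or> B = {}")
  case True
  then show ?thesis
  proof
    assume "A = {}"
    moreover have "B = {} \<or> (\<forall>b\<in>B. Min B - 1 < b)"
      using assms(2) by (metis Min_le diff_add_cancel less_add_one order_less_le_trans)
    ultimately show ?thesis by blast
  next
    assume "B = {}"
    moreover have "\<forall>a\<in>A. a < Max A + 1" using assms(1) by (meson Max_ge less_add_one order_le_less_trans)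
    ultimately show ?thesis by blast
  qed
next
  case False
  then have "Max A < Min B" using assms by (simp add: Max_in Min_in)
  then obtain z where "Max A < z" "z < Min B" using dense by blast
  then show ?thesis using assms(1,2) False by (auto simp: Max_less_iff Min_gr_iff)
qed

text \<open>The tops of the red translates and of \<open>q\<close> are parabolas of curvature \<open>- \<beta>\<close> with the same apexes, up to a common
shift. After adding \<open>\<beta> * u\<^sup>2\<close> the tops become affine functions of the abscissa \<open>u\<close>, and after subtracting \<open>\<alpha> * u\<^sup>2\<close> so do the
bottoms. If \<open>q\<close> lies beyond all red apexes horizontally, its top wins at infinity. Otherwise let \<open>i\<close> and \<open>j\<close>
be the neighbouring red apexes. If the top of \<open>q\<close> does not exceed the crossing of the tops of \<open>i\<close> and \<open>j\<close>, then
comparing the two affine pictures shows that its bottom is below the crossing of their bottoms, by at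
least \<open>(\<alpha> + \<beta>)\<close> times the product of the horizontal distances from \<open>q\<close> to \<open>i\<close> and to \<open>j\<close>.\<close>
lemma poke_or_contain:
  assumes fin: "finite R" "finite B" and sp: "spread \<alpha> \<beta> R" and ap: "apart \<alpha> (-\<beta>) R B"
    and pos: "0 < \<alpha>" "0 < \<beta>"
  obtains (far_cap) z where "elevation (-\<beta>) q z < 0" "\<And>i. i \<in> R \<Longrightarrow> 0 < elevation (-\<beta>) i z"
  | (below) i where "i \<in> R" "fst i = fst q" "snd q \<le> snd i"
  | (near_cap) z where "0 < elevation \<alpha> q z" "\<And>i. i \<in> R \<Longrightarrow> elevation \<alpha> i z < 0" "\<And>j. j \<in> B \<Longrightarrow> 0 < elevation (-\<beta>) j z"
proof -
  define T where "T = (\<lambda>i u. snd i - \<beta> * (u - fst i)\<^sup>2)"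
  define N where "N = (\<lambda>i u. snd i + \<alpha> * (u - fst i)\<^sup>2)"
  have far: thesis if u: "\<And>i. i \<in> R \<Longrightarrow> T i u < T q u" for u
  proof -
    have "\<exists>z. (\<forall>a\<in>(\<lambda>i. T i u) ` R. a < z) \<and> (\<forall>b\<in>{T q u}. z < b)"
      by (rule finite_sets_between) (use fin u in blast)+
    then obtain z where "\<forall>a\<in>(\<lambda>i. T i u) ` R. a < z" "\<forall>b\<in>{T q u}. z < b" by blast
    then show thesis by (intro far_cap[of "(u, z)"]) (auto simp: elevation_def T_def algebra_simps)
  qed
  have diff: "T q u - T i u = (2 * \<beta> * (fst q - fst i)) * u + (snd q - snd i - \<beta> * ((fst q)\<^sup>2 - (fst i)\<^sup>2))" for i u
    by (simp add: T_def power2_eq_square algebra_simps)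
  show thesis
  proof (cases "\<exists>i\<in>R. fst i \<le> fst q")
    case False
    have "eventually (\<lambda>u. \<forall>i\<in>R. T i u < T q u) at_bot"
    proof (intro eventually_ball_finite fin ballI)
      fix i assume "i \<in> R"
      with False have s: "2 * \<beta> * (fst q - fst i) < 0" using pos by (auto simp: mult_less_0_iff not_le)
      define b where "b = snd q - snd i - \<beta> * ((fst q)\<^sup>2 - (fst i)\<^sup>2)"
      have "eventually (\<lambda>u. u < - b / (2 * \<beta> * (fst q - fst i))) at_bot" by (rule eventually_gt_at_bot)
      then show "eventually (\<lambda>u. T i u < T q u) at_bot"
      proof eventually_elim
        case (elim u)
        then have "- b < u * (2 * \<beta> * (fst q - fst i))" unfolding neg_less_divide_eq[OF s] .
        then have "0 < (2 * \<beta> * (fst q - fst i)) * u + b" by (simp only: mult.commute[of u])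
        then show ?case using diff[of u i] unfolding b_def by linarith
      qed
    qed
    then obtain u where "\<forall>i\<in>R. T i u < T q u" using eventually_happens'[OF trivial_limit_at_bot_linorder] by blast
    then show thesis using far by blast
  next
    case True
    define m where "m = Max (fst ` {i\<in>R. fst i \<le> fst q})"
    have mf: "finite (fst ` {i\<in>R. fst i \<le> fst q})" "fst ` {i\<in>R. fst i \<le> fst q} \<noteq> {}" using fin True by auto
    obtain i where i: "i \<in> R" "fst i \<le> fst q" "fst i = m" using Max_in[OF mf] unfolding m_def[symmetric] by auto
    have imax: "fst k \<le> fst i" if "k \<in> R" "fst k \<le> fst q" for k
      using Max_ge[OF mf(1)] that unfolding i(3) m_def by auto
    have inj: "k = i" if "k \<in> R" "fst k = fst i" for k using sp that i(1) unfolding spread_def by (auto dest: inj_onD)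
    show thesis
    proof (cases "fst i = fst q \<and> snd q \<le> snd i")
      case True
      then show thesis using below i(1) by blast
    next
      case nb: False
      show thesis
      proof (cases "\<exists>j\<in>R. fst q < fst j")
        case False
        have "eventually (\<lambda>u. \<forall>i\<in>R. T i u < T q u) at_top"
        proof (intro eventually_ball_finite fin ballI)
          fix k assume k: "k \<in> R"
          with False have kq: "fst k \<le> fst q" by auto
          show "eventually (\<lambda>u. T k u < T q u) at_top"
          proof (cases "fst k = fst q")
            case True
            then have "fst k = fst i" using imax[OF k kq] i(2) by simp
            then have "k = i" using inj k by blast
            then have "snd k < snd q" using True nb by auto
            then show ?thesis by (simp add: T_def True)
          next
            case False
            then have s: "0 < 2 * \<beta> * (fst q - fst k)" using pos kq by simp
            define b where "b = snd q - snd k - \<beta> * ((fst q)\<^sup>2 - (fst k)\<^sup>2)"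
            have "eventually (\<lambda>u. - b / (2 * \<beta> * (fst q - fst k)) < u) at_top" by (rule eventually_gt_at_top)
            then show ?thesis
            proof eventually_elim
              case (elim u)
              then have "- b < u * (2 * \<beta> * (fst q - fst k))" unfolding pos_divide_less_eq[OF s] .
              then have "0 < (2 * \<beta> * (fst q - fst k)) * u + b" by (simp only: mult.commute[of u])
              then show ?case using diff[of u k] unfolding b_def by linarith
            qed
          qed
        qed
        then obtain u where "\<forall>i\<in>R. T i u < T q u" using eventually_happens'[OF trivial_limit_at_top_linorder] by blast
        then show thesis using far by blast
      next
        case True
        define m' where "m' = Min (fst ` {j\<in>R. fst q < fst j})"
        have mf': "finite (fst ` {j\<in>R. fst q < fst j})" "fst ` {j\<in>R. fst q < fst j} \<noteq> {}" using fin True by auto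
        obtain j where j: "j \<in> R" "fst q < fst j" "fst j = m'" using Min_in[OF mf'] unfolding m'_def[symmetric] by auto
        have jmin: "fst j \<le> fst k" if "k \<in> R" "fst q < fst k" for k
          using Min_le[OF mf'(1)] that unfolding j(3) m'_def by auto
        have injj: "k = j" if "k \<in> R" "fst k = fst j" for k using sp that j(1) unfolding spread_def by (auto dest: inj_onD)
        have ij: "0 < fst j - fst i" using i j by linarith
        define s where "s = (snd j - snd i) / (fst j - fst i)"
        have s: "s * (fst j - fst i) = snd j - snd i" using ij unfolding s_def by simp
        \<comment> \<open>\<open>D\<close> is the height over the chord through \<open>i\<close> and \<open>j\<close>; \<open>u\<close> and \<open>u'\<close> are the abscissas of the crossings of the tops and of the bottoms.\<close>
        define D where "D = (\<lambda>k. snd k - snd i - s * (fst k - fst i))"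
        define w where "w = (\<lambda>k::real \<times> real. (fst k - fst i) * (fst k - fst j))"
        define u where "u = (fst i + fst j) / 2 - s / (2 * \<beta>)"
        define u' where "u' = (fst i + fst j) / 2 + s / (2 * \<alpha>)"
        have Tu: "T k u - T i u = D k - \<beta> * w k" for k
        proof -
          have "2 * \<beta> * u = \<beta> * (fst i + fst j) - s" unfolding u_def using pos by (simp add: field_simps)
          then have "2 * \<beta> * u * (fst k - fst i) = (\<beta> * (fst i + fst j) - s) * (fst k - fst i)" by simp
          then show ?thesis unfolding T_def D_def w_def by (simp add: power2_eq_square algebra_simps)
        qed
        have Nu: "N k u' - N i u' = D k + \<alpha> * w k" for k
        proof -
          have "2 * \<alpha> * u' = \<alpha> * (fst i + fst j) + s" unfolding u'_def using pos by (simp add: field_simps)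
          then have "2 * \<alpha> * u' * (fst k - fst i) = (\<alpha> * (fst i + fst j) + s) * (fst k - fst i)" by simp
          then show ?thesis unfolding N_def D_def w_def by (simp add: power2_eq_square algebra_simps)
        qed
        have env: "- \<alpha> * w k \<le> D k \<and> D k \<le> \<beta> * w k" if k: "k \<in> R" for k
        proof -
          have key: "- \<alpha> * w k \<le> D k \<and> D k \<le> \<beta> * w k"
            if "- \<alpha> * ((fst j - fst i) * w k) < (fst j - fst i) * D k" "(fst j - fst i) * D k < \<beta> * ((fst j - fst i) * w k)"
          proof -
            have "(fst j - fst i) * (- \<alpha> * w k) < (fst j - fst i) * D k"
              "(fst j - fst i) * D k < (fst j - fst i) * (\<beta> * w k)"
              using that by (simp_all add: mult_ac)
            then show ?thesis using mult_less_cancel_left_pos[OF ij] by (metis less_imp_le)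
          qed
          have aD: "(fst j - fst i) * D k = (snd k - snd i) * (fst j - fst i) - (snd j - snd i) * (fst k - fst i)"
            unfolding D_def s[symmetric] by (simp add: algebra_simps)
          consider "fst k < fst i" | "k = i" | "k = j" | "fst j < fst k"
            using inj injj imax jmin k by (meson linorder_cases not_le order_antisym_conv less_le_not_le)
          then show ?thesis
          proof cases
            case 1
            have "- \<alpha> * vandermonde k i j < double_area k i j \<and> double_area k i j < \<beta> * vandermonde k i j"
              using sp 1 ij k i(1) j(1) unfolding spread_def by auto
            moreover have "vandermonde k i j = (fst j - fst i) * w k" unfolding vandermonde_def w_def by (simp add: algebra_simps)
            moreover have "double_area k i j = (fst j - fst i) * D k" unfolding aD double_area_def by (simp add: algebra_simps)
            ultimately show ?thesis using key by simp
          next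
            case 2 then show ?thesis by (simp add: D_def w_def)
          next
            case 3 then show ?thesis by (simp add: D_def w_def s)
          next
            case 4
            have "- \<alpha> * vandermonde i j k < double_area i j k \<and> double_area i j k < \<beta> * vandermonde i j k"
              using sp 4 ij k i(1) j(1) unfolding spread_def by auto
            moreover have "vandermonde i j k = (fst j - fst i) * w k" unfolding vandermonde_def w_def by (simp add: algebra_simps)
            moreover have "double_area i j k = (fst j - fst i) * D k" unfolding aD double_area_def by (simp add: algebra_simps)
            ultimately show ?thesis using key by simp
          qed
        qed
        have Tk: "T k u \<le> T i u" and Nk: "N i u' \<le> N k u'" if "k \<in> R" for k
          using env[OF that] Tu[of k] Nu[of k] by linarith+
        show thesis
        proof (cases "T i u < T q u")
          case True
          then show thesis using far Tk by (meson le_less_trans)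
        next
          case False
          then have Dq: "D q \<le> \<beta> * w q" using Tu[of q] by linarith
          have "fst i \<noteq> fst q"
          proof
            assume e: "fst i = fst q"
            then have "snd q \<le> snd i" using Dq by (simp add: D_def w_def)
            with e nb show False by simp
          qed
          then have wq: "w q < 0" unfolding w_def using i(2) j(2) by (intro mult_pos_neg) auto
          then have "\<beta> * w q < 0" "\<alpha> * w q < 0" using pos by (simp_all add: mult_pos_neg)
          then have Nq: "N q u' < N i u'" using Dq Nu[of q] by linarith
          have mt: "meet \<alpha> i j = (u', N i u')"
            unfolding meet_def Let_def u'_def N_def s_def using pos by (simp add: mult_ac)
          have Tb: "T b u' < N i u'" if "b \<in> B" for b
          proof -
            have "0 < \<alpha> * elevation (-\<beta>) b (meet \<alpha> i j)" using ap i(1) j(1) that ij unfolding apart_def by auto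
            then have "0 < elevation (-\<beta>) b (u', N i u')" using pos unfolding mt by (simp add: zero_less_mult_iff)
            then show ?thesis by (simp add: elevation_def T_def)
          qed
          have "\<exists>z. (\<forall>a\<in>insert (N q u') ((\<lambda>b. T b u') ` B). a < z) \<and> (\<forall>b\<in>{N i u'}. z < b)"
            by (rule finite_sets_between) (use fin Tb Nq in blast)+
          then obtain z where z: "\<forall>a\<in>insert (N q u') ((\<lambda>b. T b u') ` B). a < z" "\<forall>b\<in>{N i u'}. z < b" by blast
          show thesis
          proof (rule near_cap[of "(u', z)"])
            show "0 < elevation \<alpha> q (u', z)" using z by (simp add: elevation_def N_def)
            show "elevation \<alpha> k (u', z) < 0" if "k \<in> R" for k
              using z Nk[OF that] unfolding elevation_def N_def by simp
            show "0 < elevation (-\<beta>) b (u', z)" if "b \<in> B" for b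
            proof -
              have "T b u' < z" using z(1) that by blast
              then show ?thesis by (simp add: elevation_def T_def)
            qed
          qed
        qed
      qed
    qed
  qed
qed

section \<open>Convex sets touching a line with positive curvature\<close>

lemma compact_eventually_ball:
  assumes "compact S" and "\<And>x. x \<in> S \<Longrightarrow> eventually (\<lambda>(a, y). P a y) (F \<times>\<^sub>F nhds x)"
  shows "eventually (\<lambda>a. \<forall>x\<in>S. P a x) F"
proof -
  define \<U> where "\<U> = {U. open U \<and> eventually (\<lambda>a. \<forall>y\<in>U. P a y) F}"
  have "S \<subseteq> \<Union>\<U>"
  proof
    fix x assume "x \<in> S"
    from assms(2)[OF this] obtain Q T where QT: "eventually Q F" "eventually T (nhds x)" "\<And>a y. Q a \<Longrightarrow> T y \<Longrightarrow> P a y"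
      unfolding eventually_prod_filter by auto
    then obtain U where U: "open U" "x \<in> U" "\<forall>y\<in>U. T y" unfolding eventually_nhds by auto
    from QT(1) have "eventually (\<lambda>a. \<forall>y\<in>U. P a y) F"
      by (rule eventually_mono) (use QT(3) U(3) in blast)
    with U show "x \<in> \<Union>\<U>" unfolding \<U>_def by blast
  qed
  then obtain \<F> where \<F>: "\<F> \<subseteq> \<U>" "finite \<F>" "S \<subseteq> \<Union>\<F>"
    using compactE[OF assms(1), of \<U>] unfolding \<U>_def by blast
  have "eventually (\<lambda>a. \<forall>U\<in>\<F>. \<forall>y\<in>U. P a y) F"
    using \<F>(1) unfolding \<U>_def by (intro eventually_ball_finite[OF \<F>(2)]) blast
  then show ?thesis by (rule eventually_mono) (use \<F>(3) in blast)
qed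

text \<open>Tangency to the x-axis at the origin from above. The number \<open>\<alpha>\<close> is the coefficient of the osculating
parabola \<open>y = \<alpha> * x\<^sup>2\<close>, that is, half of the curvature in the usual normalisation.\<close>
definition touches :: "(real \<times> real) set \<Rightarrow> real \<Rightarrow> bool" where
  "touches K \<alpha> \<longleftrightarrow> open K \<and> convex K \<and> K \<subseteq> {v. 0 < snd v} \<and> 0 \<in> frontier K \<and>
     (\<forall>\<delta>>0. \<exists>\<rho>>0. \<forall>z\<in>frontier K \<inter> ball 0 \<rho>.
        (1 - \<delta>) * \<alpha> * (fst z)\<^sup>2 \<le> snd z \<and> snd z \<le> (1 + \<delta>) * \<alpha> * (fst z)\<^sup>2)"

lemma closure_nonneg: "touches K \<alpha> \<Longrightarrow> v \<in> closure K \<Longrightarrow> 0 \<le> snd v"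
proof -
  assume "touches K \<alpha>" and v: "v \<in> closure K"
  then have "K \<subseteq> {v. 0 \<le> snd v}" unfolding touches_def by auto
  moreover have "closed {v::real\<times>real. 0 \<le> snd v}" by (intro closed_Collect_le continuous_intros)
  ultimately show ?thesis using v closure_minimal by blast
qed

lemma convex_above_parabola:
  assumes "0 \<le> c" shows "convex {z::real\<times>real. c * (fst z)\<^sup>2 < snd z}"
proof (rule convexI)
  fix x y :: "real \<times> real" and u v :: real
  assume xy: "x \<in> {z. c * (fst z)\<^sup>2 < snd z}" "y \<in> {z. c * (fst z)\<^sup>2 < snd z}" and uv: "0 \<le> u" "0 \<le> v" "u + v = 1"
  have v: "v = 1 - u" using uv by simp
  have "u * (fst x)\<^sup>2 + v * (fst y)\<^sup>2 - (u * fst x + v * fst y)\<^sup>2 = u * v * (fst x - fst y)\<^sup>2"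
    unfolding v by (simp add: power2_eq_square algebra_simps)
  also have "0 \<le> \<dots>" using uv by simp
  finally have "(u * fst x + v * fst y)\<^sup>2 \<le> u * (fst x)\<^sup>2 + v * (fst y)\<^sup>2" by simp
  then have "c * (u * fst x + v * fst y)\<^sup>2 \<le> c * (u * (fst x)\<^sup>2 + v * (fst y)\<^sup>2)" using assms by (rule mult_left_mono)
  also have "\<dots> = u * (c * (fst x)\<^sup>2) + v * (c * (fst y)\<^sup>2)" by (simp add: algebra_simps)
  also have "\<dots> < u * snd x + v * snd y"
  proof (cases "u = 0")
    case True then show ?thesis using uv xy by simp
  next
    case False
    then show ?thesis using uv xy by (intro add_less_le_mono mult_strict_left_mono mult_left_mono) auto
  qed
  finally show "u *\<^sub>R x + v *\<^sub>R y \<in> {z. c * (fst z)\<^sup>2 < snd z}" by simp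
qed

text \<open>The hypothesis speaks of the frontier only; convexity turns it into a statement about \<open>K\<close>. A point of \<open>K\<close> below
the lower parabola would force a frontier point on the vertical segment down to the axis. The
region above the upper parabola in a small ball is convex, free of frontier points, and meets \<open>K\<close>
in points of a segment from the origin into \<open>K\<close>.\<close>
lemma touches_parabola_bounds:
  assumes K: "touches K \<alpha>" and "0 < \<alpha>" "0 < \<delta>"
  obtains \<rho> where "0 < \<rho>" "\<And>z. norm z < \<rho> \<Longrightarrow> (1 + \<delta>) * \<alpha> * (fst z)\<^sup>2 < snd z \<Longrightarrow> z \<in> K"
    "\<And>z. norm z < \<rho> \<Longrightarrow> snd z < (1 - \<delta>) * \<alpha> * (fst z)\<^sup>2 \<Longrightarrow> z \<notin> closure K"
proof -
  obtain \<rho> where \<rho>: "0 < \<rho>" and fr0: "\<forall>z\<in>frontier K \<inter> ball 0 \<rho>.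
        (1 - \<delta>) * \<alpha> * (fst z)\<^sup>2 \<le> snd z \<and> snd z \<le> (1 + \<delta>) * \<alpha> * (fst z)\<^sup>2"
    using K assms(3) unfolding touches_def by blast
  have fr: "(1 - \<delta>) * \<alpha> * (fst z)\<^sup>2 \<le> snd z \<and> snd z \<le> (1 + \<delta>) * \<alpha> * (fst z)\<^sup>2"
    if "z \<in> frontier K" "norm z < \<rho>" for z
    using bspec[OF fr0, of z] that by (simp add: mem_ball_0)
  have K0: "open K" "convex K" "0 \<in> closure K" "K \<subseteq> {v. 0 < snd v}"
    using K unfolding touches_def frontier_def by auto
  show thesis
  proof
    show "0 < \<rho>" by fact
  next
    fix z assume z: "norm z < \<rho>" "(1 + \<delta>) * \<alpha> * (fst z)\<^sup>2 < snd z"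
    define P where "P = {z. (1 + \<delta>) * \<alpha> * (fst z)\<^sup>2 < snd z} \<inter> ball 0 \<rho>"
    have P: "convex P" unfolding P_def using assms by (intro convex_Int convex_above_parabola convex_ball) simp
    obtain k where k: "k \<in> K" using K0(3) by (metis closure_empty empty_iff equals0I)
    have ev1: "eventually (\<lambda>s. (1 + \<delta>) * \<alpha> * s * (fst k)\<^sup>2 < snd k) (at_right 0)"
    proof (rule order_tendstoD(2))
      show "((\<lambda>s. (1 + \<delta>) * \<alpha> * s * (fst k)\<^sup>2) \<longlongrightarrow> 0) (at_right 0)" by (auto intro!: tendsto_eq_intros)
      show "0 < snd k" using k K0 by auto
    qed
    have ev2: "eventually (\<lambda>s. norm (s *\<^sub>R k) < \<rho>) (at_right 0)"
      by (rule order_tendstoD(2)[OF _ \<rho>]) (auto intro!: tendsto_eq_intros)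
    have ev3: "eventually (\<lambda>s::real. s < 1) (at_right 0)"
      by (rule order_tendstoD(2)[OF tendsto_ident_at]) simp
    obtain s where s: "(1 + \<delta>) * \<alpha> * s * (fst k)\<^sup>2 < snd k" "norm (s *\<^sub>R k) < \<rho>" "s < 1" "0 < s"
      using eventually_happens'[OF trivial_limit_at_right_real
          eventually_conj[OF ev1 eventually_conj[OF ev2 eventually_conj[OF ev3 eventually_at_right_less]]]]
      by blast
    have "s * ((1 + \<delta>) * \<alpha> * s * (fst k)\<^sup>2) < s * snd k" using s by (intro mult_strict_left_mono)
    then have sP: "s *\<^sub>R k \<in> P" using s(2) by (simp add: P_def power2_eq_square mult_ac)
    have sK: "s *\<^sub>R k \<in> K"
    proof -
      have "0 - (1 - (1 - s)) *\<^sub>R (0 - k) \<in> interior K"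
        by (rule mem_interior_closure_convex_shrink[OF K0(2) _ K0(3)]) (use k K0(1) s in \<open>simp_all add: interior_open\<close>)
      then show ?thesis using K0(1) by (simp add: interior_open)
    qed
    have zP: "z \<in> P" using z by (simp add: P_def)
    show "z \<in> K"
    proof (rule ccontr)
      assume "z \<notin> K"
      then have "P \<inter> frontier K \<noteq> {}"
        using connected_Int_frontier[OF convex_connected[OF P], of K] sP sK zP by blast
      then obtain y where y: "y \<in> frontier K" "y \<in> P" by blast
      then have "snd y \<le> (1 + \<delta>) * \<alpha> * (fst y)\<^sup>2" using fr unfolding P_def by auto
      with y(2) show False unfolding P_def by auto
    qed
  next
    fix z assume z: "norm z < \<rho>" "snd z < (1 - \<delta>) * \<alpha> * (fst z)\<^sup>2"
    show "z \<notin> closure K"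
    proof
      assume "z \<in> closure K"
      moreover have "z \<notin> frontier K" using fr z by fastforce
      ultimately have zK: "z \<in> K" using K0(1) by (simp add: frontier_def interior_open)
      have z0: "0 < snd z" using zK K0 by auto
      define L where "L = {fst z} \<times> {0..snd z}"
      have "connected L" unfolding L_def by (intro connected_Times) auto
      moreover have "z \<in> L" "(fst z, 0) \<in> L" "(fst z, 0) \<notin> K" using z0 K0 by (auto simp: L_def mem_Times_iff)
      ultimately obtain y where y: "y \<in> frontier K" "y \<in> L" using connected_Int_frontier[of L K] zK by blast
      then have y': "fst y = fst z" "0 \<le> snd y" "snd y \<le> snd z" by (auto simp: L_def)
      have "norm y \<le> norm z" using y' unfolding norm_prod_def by (simp add: power_mono)
      then have "(1 - \<delta>) * \<alpha> * (fst y)\<^sup>2 \<le> snd y" using fr[OF y(1)] z by auto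
      then show False using z y' by simp
    qed
  qed
qed

lemma zoom_tendsto_0:
  assumes "filterlim f (at_right 0) F" "(g \<longlongrightarrow> z) F"
  shows "((\<lambda>x. zoom (f x) (g x)) \<longlongrightarrow> 0) F"
proof -
  have "(f \<longlongrightarrow> 0) F" using assms(1) filterlim_at by blast
  from tendsto_zoom[OF this assms(2)] show ?thesis by simp
qed

text \<open>Together with \<open>touches_outside\<close>: the rescaled sets \<open>zoom (1 / a) K\<close> converge to the region above the
parabola, locally uniformly away from it. The general filter \<open>F\<close> lets the point vary with the
scale.\<close>
lemma touches_inside:
  assumes K: "touches K \<alpha>" and \<alpha>: "0 < \<alpha>" and f: "filterlim f (at_right 0) F" and g: "(g \<longlongrightarrow> z) F" and z: "0 < elevation \<alpha> 0 z"
  shows "eventually (\<lambda>x. zoom (f x) (g x) \<in> K) F"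
proof -
  have "((\<lambda>\<delta>. (1 + \<delta>) * \<alpha> * (fst z)\<^sup>2) \<longlongrightarrow> \<alpha> * (fst z)\<^sup>2) (at_right 0)" by (auto intro!: tendsto_eq_intros)
  then have "eventually (\<lambda>\<delta>. (1 + \<delta>) * \<alpha> * (fst z)\<^sup>2 < snd z) (at_right 0)"
    by (rule order_tendstoD(2)) (use z in \<open>simp add: elevation_def\<close>)
  then obtain \<delta> where \<delta>: "(1 + \<delta>) * \<alpha> * (fst z)\<^sup>2 < snd z" "0 < \<delta>"
    using eventually_happens'[OF trivial_limit_at_right_real eventually_conj[OF _ eventually_at_right_less]] by blast
  obtain \<rho> where \<rho>: "0 < \<rho>" "\<And>z. norm z < \<rho> \<Longrightarrow> (1 + \<delta>) * \<alpha> * (fst z)\<^sup>2 < snd z \<Longrightarrow> z \<in> K"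
    using touches_parabola_bounds[OF K \<alpha> \<delta>(2)] by metis
  have e1: "eventually (\<lambda>x. norm (zoom (f x) (g x)) < \<rho>) F"
    by (rule order_tendstoD(2)[OF tendsto_norm_zero[OF zoom_tendsto_0[OF f g]] \<rho>(1)])
  have "((\<lambda>x. snd (g x) - (1 + \<delta>) * \<alpha> * (fst (g x))\<^sup>2) \<longlongrightarrow> snd z - (1 + \<delta>) * \<alpha> * (fst z)\<^sup>2) F"
    by (intro tendsto_intros g)
  then have e2: "eventually (\<lambda>x. 0 < snd (g x) - (1 + \<delta>) * \<alpha> * (fst (g x))\<^sup>2) F"
    by (rule order_tendstoD(1)) (use \<delta> in simp)
  have e3: "eventually (\<lambda>x. 0 < f x) F" using f unfolding filterlim_at by (auto elim: eventually_mono)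
  show ?thesis using e1 e2 e3
  proof eventually_elim
    case (elim x)
    have "0 < (f x)\<^sup>2 * (snd (g x) - (1 + \<delta>) * \<alpha> * (fst (g x))\<^sup>2)" using elim by simp
    then have "(1 + \<delta>) * \<alpha> * (fst (zoom (f x) (g x)))\<^sup>2 < snd (zoom (f x) (g x))"
      by (simp add: zoom_def power2_eq_square algebra_simps)
    then show ?case using \<rho>(2) elim(1) by blast
  qed
qed

lemma touches_outside:
  assumes K: "touches K \<alpha>" and \<alpha>: "0 < \<alpha>" and f: "filterlim f (at_right 0) F" and g: "(g \<longlongrightarrow> z) F" and z: "elevation \<alpha> 0 z < 0"
  shows "eventually (\<lambda>x. zoom (f x) (g x) \<notin> closure K) F"
proof -
  have "((\<lambda>\<delta>. (1 - \<delta>) * \<alpha> * (fst z)\<^sup>2) \<longlongrightarrow> \<alpha> * (fst z)\<^sup>2) (at_right 0)" by (auto intro!: tendsto_eq_intros)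
  then have "eventually (\<lambda>\<delta>. snd z < (1 - \<delta>) * \<alpha> * (fst z)\<^sup>2) (at_right 0)"
    by (rule order_tendstoD(1)) (use z in \<open>simp add: elevation_def\<close>)
  then obtain \<delta> where \<delta>: "snd z < (1 - \<delta>) * \<alpha> * (fst z)\<^sup>2" "0 < \<delta>"
    using eventually_happens'[OF trivial_limit_at_right_real eventually_conj[OF _ eventually_at_right_less]] by blast
  obtain \<rho> where \<rho>: "0 < \<rho>" "\<And>z. norm z < \<rho> \<Longrightarrow> snd z < (1 - \<delta>) * \<alpha> * (fst z)\<^sup>2 \<Longrightarrow> z \<notin> closure K"
    using touches_parabola_bounds[OF K \<alpha> \<delta>(2)] by metis
  have e1: "eventually (\<lambda>x. norm (zoom (f x) (g x)) < \<rho>) F"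
    by (rule order_tendstoD(2)[OF tendsto_norm_zero[OF zoom_tendsto_0[OF f g]] \<rho>(1)])
  have "((\<lambda>x. (1 - \<delta>) * \<alpha> * (fst (g x))\<^sup>2 - snd (g x)) \<longlongrightarrow> (1 - \<delta>) * \<alpha> * (fst z)\<^sup>2 - snd z) F"
    by (intro tendsto_intros g)
  then have e2: "eventually (\<lambda>x. 0 < (1 - \<delta>) * \<alpha> * (fst (g x))\<^sup>2 - snd (g x)) F"
    by (rule order_tendstoD(1)) (use \<delta> in simp)
  have e3: "eventually (\<lambda>x. 0 < f x) F" using f unfolding filterlim_at by (auto elim: eventually_mono)
  show ?thesis using e1 e2 e3
  proof eventually_elim
    case (elim x)
    have "0 < (f x)\<^sup>2 * ((1 - \<delta>) * \<alpha> * (fst (g x))\<^sup>2 - snd (g x))" using elim by simp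
    then have "snd (zoom (f x) (g x)) < (1 - \<delta>) * \<alpha> * (fst (zoom (f x) (g x)))\<^sup>2"
      by (simp add: zoom_def power2_eq_square algebra_simps)
    then show ?case using \<rho>(2) elim(1) by blast
  qed
qed

text \<open>A point of the closure that is too far out at low height can be contracted towards the origin, by
convexity, until it violates the local bound.\<close>
lemma touches_narrow:
  assumes K: "touches K \<alpha>" and \<alpha>: "0 < \<alpha>"
  obtains N where "0 < N" "eventually (\<lambda>a. \<forall>v\<in>closure K. snd v \<le> a\<^sup>2 * M \<longrightarrow> \<bar>fst v\<bar> \<le> a * N) (at_right 0)"
proof -
  have cv: "convex (closure K)" "0 \<in> closure K" using K unfolding touches_def frontier_def by (auto intro: convex_closure)
  define N where "N = sqrt (2 * (\<bar>M\<bar> + 1) / \<alpha>)"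
  have N2: "N\<^sup>2 = 2 * (\<bar>M\<bar> + 1) / \<alpha>" unfolding N_def using \<alpha> by simp
  have N: "0 < N" "\<bar>M\<bar> < (1 - 1/2) * \<alpha> * N\<^sup>2" unfolding N2 using \<alpha> by (simp_all add: N_def)
  obtain \<rho> where \<rho>: "0 < \<rho>" "\<And>z. norm z < \<rho> \<Longrightarrow> snd z < (1 - 1/2) * \<alpha> * (fst z)\<^sup>2 \<Longrightarrow> z \<notin> closure K"
    using touches_parabola_bounds[OF K \<alpha>, of "1/2"] by (metis half_gt_zero zero_less_one)
  have "eventually (\<lambda>a. norm (zoom a (N, \<bar>M\<bar>)) < \<rho>) (at_right 0)"
    by (rule order_tendstoD(2)[OF tendsto_norm_zero[OF zoom_tendsto_origin] \<rho>(1)])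
  then have "eventually (\<lambda>a. \<forall>v\<in>closure K. snd v \<le> a\<^sup>2 * M \<longrightarrow> \<bar>fst v\<bar> \<le> a * N) (at_right 0)"
    using eventually_at_right_pos
  proof eventually_elim
    case (elim a)
    show ?case
    proof (intro ballI impI, rule ccontr)
      fix v assume v: "v \<in> closure K" "snd v \<le> a\<^sup>2 * M" "\<not> \<bar>fst v\<bar> \<le> a * N"
      have aN: "0 < a * N" using elim N by simp
      define s where "s = a * N / \<bar>fst v\<bar>"
      have s: "0 < s" "s < 1" "s * \<bar>fst v\<bar> = a * N" using v(3) aN by (auto simp: s_def)
      have w: "s *\<^sub>R v \<in> closure K"
        using convexD[OF cv(1) v(1) cv(2), of s "1 - s"] s by simp
      have v0: "0 \<le> snd v" using closure_nonneg[OF K v(1)] .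
      have "s * snd v \<le> 1 * snd v" using s v0 by (intro mult_right_mono) auto
      also have "\<dots> \<le> a\<^sup>2 * \<bar>M\<bar>" using v(2) by (smt (verit) mult_left_mono zero_le_power2)
      finally have sv: "s * snd v \<le> a\<^sup>2 * \<bar>M\<bar>" by simp
      have sf: "(s * fst v)\<^sup>2 = (a * N)\<^sup>2"
        using s by (metis abs_mult abs_of_pos power2_abs)
      have "norm (s *\<^sub>R v) \<le> norm (zoom a (N, \<bar>M\<bar>))"
      proof -
        have "(s * snd v)\<^sup>2 \<le> (a\<^sup>2 * \<bar>M\<bar>)\<^sup>2" using sv v0 s by (intro power_mono) auto
        then show ?thesis unfolding norm_prod_def by (simp add: zoom_def sf)
      qed
      then have "norm (s *\<^sub>R v) < \<rho>" using elim(1) by simp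
      moreover have "snd (s *\<^sub>R v) < (1 - 1/2) * \<alpha> * (fst (s *\<^sub>R v))\<^sup>2"
      proof -
        have "s * snd v \<le> a\<^sup>2 * \<bar>M\<bar>" by (rule sv)
        also have "\<dots> < a\<^sup>2 * ((1 - 1/2) * \<alpha> * N\<^sup>2)" using N elim(2) by (intro mult_strict_left_mono) auto
        also have "\<dots> = (1 - 1/2) * \<alpha> * (a * N)\<^sup>2" by (simp add: power_mult_distrib)
        finally show ?thesis unfolding sf[symmetric] by simp
      qed
      ultimately show False using \<rho>(2) w by blast
    qed
  qed
  with N(1) show thesis by (rule that)
qed

section \<open>Exposed translates\<close>

lemma elevation_diff [simp]: "elevation c 0 (v - q) = elevation c q v"
  by (simp add: elevation_def)

lemma zoom_diff: "zoom a v - zoom a q = zoom a (v - q)"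
  by (simp add: zoom_def algebra_simps)

lemma zoom_minus: "zoom a (- v) = - zoom a v"
  by (simp add: zoom_def)

text \<open>A convex set touching two parallel lines: the x-axis at the origin and the line through \<open>t\<close>, in the
reflected sense, at \<open>t\<close>. The reflected set \<open>(-) t ` K\<close> is again of this kind, which turns every
statement about the bottom into one about the top.\<close>
locale lens =
  fixes K :: "(real \<times> real) set" and t :: "real \<times> real" and \<alpha> \<beta> :: real
  assumes bottom: "touches K \<alpha>" and top: "touches ((-) t ` K) \<beta>" and pos: "0 < \<alpha>" "0 < \<beta>"
begin

lemma mem_dual: "v \<in> (-) t ` S \<longleftrightarrow> t - v \<in> S"
proof
  assume "t - v \<in> S"
  then have "t - (t - v) \<in> (-) t ` S" by (rule imageI)
  then show "v \<in> (-) t ` S" by simp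
qed auto

lemma closure_dual: "closure ((-) t ` K) = (-) t ` closure K"
proof -
  have *: "(-) t ` S = (+) t ` uminus ` S" for S by (auto simp: image_image)
  have "uminus ` closure K = closure (uminus ` K)"
    by (rule closure_injective_linear_image) (auto simp: inj_def intro!: linear_uminus)
  then show ?thesis unfolding * by (simp only: closure_translation)
qed

lemma dual: "lens ((-) t ` K) t \<beta> \<alpha>"
proof
  have "(-) t ` (-) t ` K = K" by (auto simp: image_image)
  then show "touches ((-) t ` (-) t ` K) \<alpha>" using bottom by simp
qed (use top pos in auto)

lemma openK: "open K" and convexK: "convex K"
  using bottom unfolding touches_def by auto

lemma closure_bounds: "v \<in> closure K \<Longrightarrow> 0 \<le> snd v" "v \<in> closure K \<Longrightarrow> snd v \<le> snd t"
proof -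
  assume v: "v \<in> closure K"
  show "0 \<le> snd v" by (rule closure_nonneg[OF bottom v])
  have "t - v \<in> closure ((-) t ` K)" using v unfolding closure_dual by blast
  from closure_nonneg[OF top this] show "snd v \<le> snd t" by simp
qed

lemma apex: "t \<in> closure K"
proof -
  have "0 \<in> closure ((-) t ` K)" using top unfolding touches_def frontier_def by auto
  then show ?thesis unfolding closure_dual mem_dual by simp
qed

lemma height: "0 < snd t"
proof -
  obtain k where k: "k \<in> K" using apex by (metis closure_empty empty_iff equals0I)
  then have "0 < snd k" "snd k \<le> snd t"
    using bottom closure_bounds(2)[OF subsetD[OF closure_subset k]] k unfolding touches_def by auto
  then show ?thesis by simp
qed

lemmas bottom_inside = touches_inside[OF bottom pos(1)]
lemmas bottom_outside = touches_outside[OF bottom pos(1)]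

lemma top_inside:
  assumes "filterlim f (at_right 0) F" "(g \<longlongrightarrow> z) F" "elevation (-\<beta>) 0 z < 0"
  shows "eventually (\<lambda>x. t + zoom (f x) (g x) \<in> K) F"
proof -
  have "0 < elevation \<beta> 0 (- z)" using assms(3) by (simp add: elevation_def)
  from touches_inside[OF top pos(2) assms(1) tendsto_minus[OF assms(2)] this]
  show ?thesis unfolding mem_dual zoom_minus by simp
qed

lemma top_outside:
  assumes "filterlim f (at_right 0) F" "(g \<longlongrightarrow> z) F" "0 < elevation (-\<beta>) 0 z"
  shows "eventually (\<lambda>x. t + zoom (f x) (g x) \<notin> closure K) F"
proof -
  have "elevation \<beta> 0 (- z) < 0" using assms(3) by (simp add: elevation_def)
  from touches_outside[OF top pos(2) assms(1) tendsto_minus[OF assms(2)] this]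
  show ?thesis unfolding closure_dual mem_dual zoom_minus by simp
qed

lemma top_narrow:
  obtains N where "0 < N" "eventually (\<lambda>a. \<forall>v\<in>closure K. snd t - a\<^sup>2 * M \<le> snd v \<longrightarrow> \<bar>fst v - fst t\<bar> \<le> a * N) (at_right 0)"
proof -
  obtain N where N: "0 < N" "eventually (\<lambda>a. \<forall>v\<in>closure ((-) t ` K). snd v \<le> a\<^sup>2 * M \<longrightarrow> \<bar>fst v\<bar> \<le> a * N) (at_right 0)"
    by (rule touches_narrow[OF top pos(2)])
  from N(2) have "eventually (\<lambda>a. \<forall>v\<in>closure K. snd t - a\<^sup>2 * M \<le> snd v \<longrightarrow> \<bar>fst v - fst t\<bar> \<le> a * N) (at_right 0)"
  proof eventually_elim
    case (elim a)
    show ?case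
    proof (intro ballI impI)
      fix v assume v: "v \<in> closure K" "snd t - a\<^sup>2 * M \<le> snd v"
      have "t - v \<in> closure ((-) t ` K)" using v unfolding closure_dual by blast
      moreover have "snd (t - v) \<le> a\<^sup>2 * M" using v(2) by simp
      ultimately have "\<bar>fst (t - v)\<bar> \<le> a * N" using elim by blast
      then show "\<bar>fst v - fst t\<bar> \<le> a * N" by (simp add: abs_minus_commute)
    qed
  qed
  with N(1) show thesis by (rule that)
qed

text \<open>Closures make exposure an open condition on \<open>z\<close>, so that an exposed translate contains infinitely many
filler points. A red edge is \<open>zoom a i + K\<close> with lowest
point \<open>zoom a i\<close>; a blue one is \<open>zoom a b - t + K\<close> with highest point \<open>zoom a b\<close>.\<close>
definition exposed :: "real \<Rightarrow> (real \<times> real) set \<Rightarrow> (real \<times> real) set \<Rightarrow> real \<times> real \<Rightarrow> bool" where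
  "exposed a R B q \<longleftrightarrow> (\<exists>z. z - q \<in> K \<and> (\<forall>i\<in>R. z - zoom a i \<notin> closure K) \<and>
     (\<forall>b\<in>B. z - zoom a b + t \<notin> closure K))"

lemma near_apex: assumes "0 < e" obtains k where "k \<in> K" "\<bar>fst k - fst t\<bar> < e" "snd t - e < snd k"
proof -
  obtain k where k: "k \<in> K" "dist k t < e" using apex assms unfolding closure_approachable by blast
  have "\<bar>fst k - fst t\<bar> < e" "\<bar>snd k - snd t\<bar> < e"
    using k(2) dist_fst_le[of k t] dist_snd_le[of k t] by (auto simp: dist_real_def)
  then show thesis using that k(1) by auto
qed

text \<open>The three alternatives of \<open>poke_or_contain\<close> are strict inequalities, hence persist for small \<open>a\<close> and nearby
\<open>p\<close>.\<close>
lemma upper_local: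
  assumes fin: "finite R" "finite B" "finite V" and sp: "spread \<alpha> \<beta> R" and ap: "apart \<alpha> (-\<beta>) R B"
  shows "eventually (\<lambda>(a, p). exposed a R B (zoom a p) \<or> (\<exists>i\<in>R. \<forall>v\<in>V. 0 < elevation \<alpha> i v \<longrightarrow> zoom a v - zoom a p \<in> K))
     (at_right 0 \<times>\<^sub>F nhds q)"
proof -
  let ?F = "at_right (0::real) \<times>\<^sub>F nhds q"
  have f: "filterlim fst (at_right 0) ?F" by (rule filterlim_fst)
  have g: "(snd \<longlongrightarrow> q) ?F" by (rule filterlim_snd)
  have g': "((\<lambda>x. v - snd x) \<longlongrightarrow> v - q) ?F" for v by (intro tendsto_intros g)
  have "eventually (\<lambda>x. exposed (fst x) R B (zoom (fst x) (snd x)) \<or> (\<exists>i\<in>R. \<forall>v\<in>V. 0 < elevation \<alpha> i v \<longrightarrow> zoom (fst x) v - zoom (fst x) (snd x) \<in> K)) ?F"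
  proof (rule poke_or_contain[OF fin(1,2) sp ap pos, of q], goal_cases far_cap below near_cap)
    case (far_cap z)
    have 1: "eventually (\<lambda>x. t + zoom (fst x) (z - snd x) \<in> K) ?F"
      by (rule top_inside[OF f g']) (use far_cap in simp)
    have 2: "eventually (\<lambda>x. \<forall>i\<in>R. t + zoom (fst x) (z - i) \<notin> closure K) ?F"
      by (intro eventually_ball_finite fin ballI top_outside[OF f tendsto_const]) (use far_cap in simp)
    have 3: "eventually (\<lambda>x. \<forall>b\<in>B. - snd t < snd (zoom (fst x) (z - b))) ?F"
    proof (intro eventually_ball_finite fin ballI)
      fix b
      have "((\<lambda>x. snd (zoom (fst x) (z - b))) \<longlongrightarrow> snd (0::real\<times>real)) ?F"
        by (intro tendsto_snd zoom_tendsto_0[OF f tendsto_const])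
      then show "eventually (\<lambda>x. - snd t < snd (zoom (fst x) (z - b))) ?F"
        by (rule order_tendstoD(1)) (use height in simp)
    qed
    from 1 2 3 show ?thesis
    proof eventually_elim
      case (elim x)
      let ?a = "fst x"
      have "(t + zoom ?a z) - zoom ?a (snd x) \<in> K" using elim(1) by (simp add: zoom_diff add_diff_eq[symmetric])
      moreover have "\<forall>i\<in>R. (t + zoom ?a z) - zoom ?a i \<notin> closure K"
        using elim(2) by (simp add: zoom_diff add_diff_eq[symmetric])
      moreover have "(t + zoom ?a z) - zoom ?a b + t \<notin> closure K" if "b \<in> B" for b
      proof
        assume "(t + zoom ?a z) - zoom ?a b + t \<in> closure K"
        from closure_bounds(2)[OF this] have "snd (zoom ?a (z - b)) \<le> - snd t" by (simp flip: zoom_diff)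
        with elim(3) that show False by force
      qed
      ultimately show ?case unfolding exposed_def by blast
    qed
  next
    case (below i)
    have "eventually (\<lambda>x. \<forall>v\<in>V. 0 < elevation \<alpha> i v \<longrightarrow> zoom (fst x) (v - snd x) \<in> K) ?F"
    proof (intro eventually_ball_finite fin ballI)
      fix v
      show "eventually (\<lambda>x. 0 < elevation \<alpha> i v \<longrightarrow> zoom (fst x) (v - snd x) \<in> K) ?F"
      proof (cases "0 < elevation \<alpha> i v")
        case True
        then have "0 < elevation \<alpha> 0 (v - q)" using below by (simp add: elevation_def)
        then have "eventually (\<lambda>x. zoom (fst x) (v - snd x) \<in> K) ?F" by (rule bottom_inside[OF f g'])
        then show ?thesis by (rule eventually_mono) simp
      qed simp
    qed
    then show ?thesis
      by (rule eventually_mono) (use below(1) in \<open>auto simp: zoom_diff\<close>)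
  next
    case (near_cap z)
    have 1: "eventually (\<lambda>x. zoom (fst x) (z - snd x) \<in> K) ?F"
      by (rule bottom_inside[OF f g']) (use near_cap in simp)
    have 2: "eventually (\<lambda>x. \<forall>i\<in>R. zoom (fst x) (z - i) \<notin> closure K) ?F"
      by (intro eventually_ball_finite fin ballI bottom_outside[OF f tendsto_const]) (use near_cap in simp)
    have 3: "eventually (\<lambda>x. \<forall>b\<in>B. t + zoom (fst x) (z - b) \<notin> closure K) ?F"
      by (intro eventually_ball_finite fin ballI top_outside[OF f tendsto_const]) (use near_cap in simp)
    from 1 2 3 show ?thesis
    proof eventually_elim
      case (elim x)
      then have "exposed (fst x) R B (zoom (fst x) (snd x))"
        unfolding exposed_def by (intro exI[of _ "zoom (fst x) z"]) (simp add: zoom_diff add.commute)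
      then show ?case ..
    qed
  qed
  then show ?thesis by (simp add: case_prod_unfold)
qed

lemma bounded_coords:
  assumes "finite (Q :: (real \<times> real) set)"
  obtains M where "0 \<le> M" "\<And>i. i \<in> Q \<Longrightarrow> \<bar>fst i\<bar> \<le> M \<and> \<bar>snd i\<bar> \<le> M"
proof -
  obtain M where M: "\<And>i. i \<in> Q \<Longrightarrow> norm i \<le> M" using finite_imp_bounded[OF assms] unfolding bounded_iff by blast
  have "\<bar>fst i\<bar> \<le> norm i" "\<bar>snd i\<bar> \<le> norm i" for i :: "real \<times> real"
    using norm_fst_le[of "fst i" "snd i"] norm_snd_le[of "snd i" "fst i"] by simp_all
  then show thesis using M that[of "max M 0"] by (meson max.coboundedI1 max.cobounded2 order_trans)
qed

text \<open>Translates above the window, or beside it, stick out of the red edges near their highest point, and the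
blue edges are much lower. The others have their lowest point in a compact part of the rescaled window, where
\<open>upper_local\<close> holds uniformly.\<close>
lemma upper:
  assumes fin: "finite R" "finite B" "finite V" and sp: "spread \<alpha> \<beta> R" and ap: "apart \<alpha> (-\<beta>) R B"
  shows "eventually (\<lambda>a. \<forall>q. - a\<^sup>2 * M \<le> snd q \<longrightarrow>
     exposed a R B q \<or> (\<exists>i\<in>R. \<forall>v\<in>V. 0 < elevation \<alpha> i v \<longrightarrow> zoom a v - q \<in> K)) (at_right 0)"
proof -
  obtain M0 where M0: "0 \<le> M0" "\<And>i. i \<in> R \<union> B \<Longrightarrow> \<bar>fst i\<bar> \<le> M0 \<and> \<bar>snd i\<bar> \<le> M0"
    using bounded_coords[of "R \<union> B"] fin by auto
  obtain N where N: "0 < N" "eventually (\<lambda>a. \<forall>v\<in>closure K. snd t - a\<^sup>2 * (M + M0 + 1) \<le> snd v \<longrightarrow> \<bar>fst v - fst t\<bar> \<le> a * N) (at_right 0)"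
    by (rule top_narrow)
  define M3 where "M3 = N + M0 + 1"
  have c: "compact (cbox (- M3, - M) (M3, M0))" by (rule compact_cbox)
  have central: "eventually (\<lambda>a. \<forall>p\<in>cbox (- M3, - M) (M3, M0). exposed a R B (zoom a p) \<or>
      (\<exists>i\<in>R. \<forall>v\<in>V. 0 < elevation \<alpha> i v \<longrightarrow> zoom a v - zoom a p \<in> K)) (at_right 0)"
    by (rule compact_eventually_ball[OF c upper_local[OF fin sp ap]])
  have small: "eventually (\<lambda>a. a\<^sup>2 * (M + M0 + 1) < snd t) (at_right 0)"
    by (rule order_tendstoD(2)[OF _ height]) (auto intro!: tendsto_eq_intros)
  show ?thesis using central N(2) small eventually_at_right_pos
  proof eventually_elim
    case (elim a)
    have a2: "0 < a\<^sup>2" using elim by simp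
    have ht: "\<bar>snd (zoom a i)\<bar> \<le> a\<^sup>2 * M0" if "i \<in> R \<union> B" for i
      using M0(2)[OF that] a2 by (simp add: zoom_def abs_mult)
    have wd: "\<bar>fst (zoom a i)\<bar> \<le> a * M0" if "i \<in> R \<union> B" for i
      using M0(2)[OF that] elim(4) by (simp add: zoom_def abs_mult)
    show ?case
    proof (intro allI impI)
      fix q :: "real \<times> real" assume q: "- a\<^sup>2 * M \<le> snd q"
      consider "a\<^sup>2 * M0 < snd q" | "snd q \<le> a\<^sup>2 * M0" "a * M3 < \<bar>fst q\<bar>" | "snd q \<le> a\<^sup>2 * M0" "\<bar>fst q\<bar> \<le> a * M3"
        by linarith
      then show "exposed a R B q \<or> (\<exists>i\<in>R. \<forall>v\<in>V. 0 < elevation \<alpha> i v \<longrightarrow> zoom a v - q \<in> K)"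
      proof cases
        case 1
        then have "0 < snd q - a\<^sup>2 * M0" by simp
        from near_apex[OF this] obtain k where k: "k \<in> K" "snd t - (snd q - a\<^sup>2 * M0) < snd k" by metis
        have "(q + k) - zoom a i \<notin> closure K" "(q + k) - zoom a i + t \<notin> closure K" if "i \<in> R \<union> B" for i
        proof -
          have "snd t < snd ((q + k) - zoom a i)" using ht[OF that] k(2) by auto
          with height show "(q + k) - zoom a i \<notin> closure K" "(q + k) - zoom a i + t \<notin> closure K"
            by (auto dest: closure_bounds(2))
        qed
        then have "exposed a R B q" unfolding exposed_def using k(1) by (intro exI[of _ "q + k"]) auto
        then show ?thesis ..
      next
        case 2
        have "0 < min a (a\<^sup>2)" using elim(4) by simp
        from near_apex[OF this] obtain k where k: "k \<in> K" "\<bar>fst k - fst t\<bar> < min a (a\<^sup>2)" "snd t - min a (a\<^sup>2) < snd k"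
          by metis
        have k': "\<bar>fst k - fst t\<bar> < a" "snd t - a\<^sup>2 < snd k" using k by auto
        have zs: "snd t - a\<^sup>2 * (M + M0 + 1) \<le> snd ((q + k) - zoom a i)" if "i \<in> R \<union> B" for i
          using ht[OF that] k'(2) q by (simp add: algebra_simps)
        have "(q + k) - zoom a i \<notin> closure K" if "i \<in> R" for i
        proof
          assume "(q + k) - zoom a i \<in> closure K"
          then have "\<bar>fst ((q + k) - zoom a i) - fst t\<bar> \<le> a * N" using elim(2) zs that by blast
          moreover have "\<bar>fst (zoom a i)\<bar> \<le> a * M0" using wd that by blast
          moreover have "a * M3 = a * N + a * M0 + a" by (simp add: M3_def algebra_simps)
          ultimately show False using 2(2) k'(1) by (simp add: abs_le_iff) linarith
        qed
        moreover have "(q + k) - zoom a b + t \<notin> closure K" if "b \<in> B" for b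
        proof
          assume "(q + k) - zoom a b + t \<in> closure K"
          from closure_bounds(2)[OF this] have "snd ((q + k) - zoom a b) \<le> 0" by simp
          then show False using zs[of b] that elim(3) by auto
        qed
        ultimately have "exposed a R B q" unfolding exposed_def using k(1) by (intro exI[of _ "q + k"]) auto
        then show ?thesis ..
      next
        case 3
        define p where "p = (fst q / a, snd q / a\<^sup>2)"
        have qp: "q = zoom a p" using elim(4) by (simp add: p_def zoom_def)
        have "p \<in> cbox (- M3, - M) (M3, M0)"
          using q 3 elim(4) unfolding p_def cbox_Pair_eq
          by (simp add: field_simps abs_le_iff)
        then show ?thesis using elim(1) unfolding qp by blast
      qed
    qed
  qed
qed

text \<open>At level 0 all edges stay within a distance of order \<open>a\<close> from the origin, because each of them is within
order \<open>a\<^sup>2\<close> of its lowest or highest level there. By convexity, \<open>K\<close> is at intermediate levels at least as wide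
as near its ends, and this width is made to exceed that of the edges by taking \<open>M\<close> large.\<close>
lemma middle:
  assumes fin: "finite R" "finite B"
  obtains M where "eventually (\<lambda>a. \<forall>q. a\<^sup>2 * M \<le> - snd q \<and> - snd q \<le> snd t - a\<^sup>2 * M \<longrightarrow> exposed a R B q) (at_right 0)"
proof -
  obtain M0 where M0: "0 \<le> M0" "\<And>i. i \<in> R \<union> B \<Longrightarrow> \<bar>fst i\<bar> \<le> M0 \<and> \<bar>snd i\<bar> \<le> M0"
    using bounded_coords[of "R \<union> B"] fin by auto
  obtain N1 where N1: "0 < N1" "eventually (\<lambda>a. \<forall>v\<in>closure K. snd v \<le> a\<^sup>2 * M0 \<longrightarrow> \<bar>fst v\<bar> \<le> a * N1) (at_right 0)"
    by (rule touches_narrow[OF bottom pos(1)])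
  obtain N2 where N2: "0 < N2" "eventually (\<lambda>a. \<forall>v\<in>closure K. snd t - a\<^sup>2 * M0 \<le> snd v \<longrightarrow> \<bar>fst v - fst t\<bar> \<le> a * N2) (at_right 0)"
    by (rule top_narrow)
  \<comment> \<open>\<open>A\<close> is the half-width to be reached in units of \<open>a\<close>; a parabola of curvature \<open>c\<close> attains it at height \<open>c * A\<^sup>2\<close>.\<close>
  define A where "A = N1 + N2 + M0 + 1"
  define M where "M = (\<alpha> + \<beta>) * A\<^sup>2 + 1"
  have "0 \<le> \<alpha> * A\<^sup>2" "0 \<le> \<beta> * A\<^sup>2" using pos by simp_all
  then have M: "\<alpha> * A\<^sup>2 < M" "\<beta> * A\<^sup>2 < M" unfolding M_def distrib_right by linarith+
  have id: "filterlim (\<lambda>a::real. a) (at_right 0) (at_right 0)" by (rule filterlim_ident)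
  have P: "eventually (\<lambda>a. zoom a (s * A, M) \<in> K) (at_right 0)" if "s\<^sup>2 = 1" for s
    by (rule bottom_inside[OF id tendsto_const]) (use M that in \<open>simp add: elevation_def power_mult_distrib\<close>)
  have Q: "eventually (\<lambda>a. t + zoom a (s * A, - M) \<in> K) (at_right 0)" if "s\<^sup>2 = 1" for s
    by (rule top_inside[OF id tendsto_const]) (use M that in \<open>simp add: elevation_def power_mult_distrib\<close>)
  have small: "eventually (\<lambda>a. 2 * a\<^sup>2 * M < snd t) (at_right 0)"
    by (rule order_tendstoD(2)[OF _ height]) (auto intro!: tendsto_eq_intros)
  have "eventually (\<lambda>a. \<forall>q. a\<^sup>2 * M \<le> - snd q \<and> - snd q \<le> snd t - a\<^sup>2 * M \<longrightarrow> exposed a R B q) (at_right 0)"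
    using P[of 1, simplified] P[of "-1", simplified] Q[of 1, simplified] Q[of "-1", simplified] small N1(2) N2(2) eventually_at_right_pos
  proof eventually_elim
    case (elim a)
    have ht: "\<bar>snd (zoom a i)\<bar> \<le> a\<^sup>2 * M0" if "i \<in> R \<union> B" for i
      using M0(2)[OF that] elim(8) by (simp add: zoom_def abs_mult)
    have wd: "\<bar>fst (zoom a i)\<bar> \<le> a * M0" if "i \<in> R \<union> B" for i
      using M0(2)[OF that] elim(8) by (simp add: zoom_def abs_mult)
    show ?case
    proof (intro allI impI)
      fix q :: "real \<times> real" assume q: "a\<^sup>2 * M \<le> - snd q \<and> - snd q \<le> snd t - a\<^sup>2 * M"
      define H where "H = snd t - 2 * a\<^sup>2 * M"
      have H: "0 < H" using elim(5) by (simp add: H_def)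
      define s where "s = (- snd q - a\<^sup>2 * M) / H"
      have s: "0 \<le> s" "s \<le> 1" "s * H = - snd q - a\<^sup>2 * M" using q H by (auto simp: s_def H_def field_simps)
      define k where "k = (\<lambda>\<sigma>::real. (1 - s) *\<^sub>R zoom a (\<sigma> * A, M) + s *\<^sub>R (t + zoom a (\<sigma> * A, - M)))"
      have kK: "k 1 \<in> K" "k (-1) \<in> K" unfolding k_def using elim(1-4) s
        by (auto intro!: convexD[OF convexK])
      have ks: "snd (k \<sigma>) = - snd q" and kf: "fst (k \<sigma>) = \<sigma> * (a * A) + s * fst t" for \<sigma>
        using s(3) unfolding k_def zoom_def H_def by (simp_all add: algebra_simps)
      have "a * A \<le> \<bar>fst q + fst (k 1)\<bar> \<or> a * A \<le> \<bar>fst q + fst (k (-1))\<bar>"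
      proof -
        have "d \<le> \<bar>x + d\<bar> \<or> d \<le> \<bar>x - d\<bar>" for x d :: real by arith
        from this[of "a * A" "fst q + s * fst t"] show ?thesis unfolding kf by (simp add: algebra_simps)
      qed
      then have "\<exists>\<sigma>\<in>{1, -1}. a * A \<le> \<bar>fst q + fst (k \<sigma>)\<bar>" by blast
      then obtain \<sigma> where \<sigma>: "\<sigma> \<in> {1, -1}" "a * A \<le> \<bar>fst q + fst (k \<sigma>)\<bar>" by blast
      define z where "z = q + k \<sigma>"
      have z: "z - q \<in> K" "snd z = 0" "a * A \<le> \<bar>fst z\<bar>"
        using kK \<sigma> ks[of \<sigma>] by (auto simp: z_def)
      have aA: "a * A = a * N1 + a * N2 + a * M0 + a" by (simp add: A_def algebra_simps)
      have aN: "0 < a * N1" "0 < a * N2" using N1(1) N2(1) elim(8) by simp_all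
      have "z - zoom a i \<notin> closure K" if "i \<in> R" for i
      proof
        assume "z - zoom a i \<in> closure K"
        moreover have "snd (z - zoom a i) \<le> a\<^sup>2 * M0" using ht[of i] that z(2) by (simp add: abs_le_iff)
        ultimately have "\<bar>fst (z - zoom a i)\<bar> \<le> a * N1" using elim(6) by blast
        then show False using wd[of i] that z(3) aA aN elim(8) by (simp add: abs_le_iff) linarith
      qed
      moreover have "z - zoom a b + t \<notin> closure K" if "b \<in> B" for b
      proof
        assume "z - zoom a b + t \<in> closure K"
        moreover have "snd t - a\<^sup>2 * M0 \<le> snd (z - zoom a b + t)" using ht[of b] that z(2) by (simp add: abs_le_iff)
        ultimately have "\<bar>fst (z - zoom a b + t) - fst t\<bar> \<le> a * N2" using elim(7) by blast
        then show False using wd[of b] that z(3) aA aN elim(8) by (simp add: abs_le_iff) linarith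
      qed
      ultimately show "exposed a R B q" unfolding exposed_def using z(1) by blast
    qed
  qed
  then show thesis by (rule that)
qed

end

lemma ex_minus: "(\<exists>z::'a::group_add. P (- z)) \<longleftrightarrow> (\<exists>z. P z)"
  by (metis minus_minus)

context lens begin

text \<open>Point reflection turns \<open>q + K\<close> into the translate of the reflected set by \<open>- q - t\<close>, and exchanges red and
blue edges.\<close>
lemma exposed_dual: "lens.exposed ((-) t ` K) t a (uminus ` B) (uminus ` R) (- q - t) \<longleftrightarrow> exposed a R B q"
proof -
  interpret D: lens "(-) t ` K" t \<beta> \<alpha> by (rule dual)
  have m: "z \<in> (-) t ` K \<longleftrightarrow> t - z \<in> K" "z \<in> closure ((-) t ` K) \<longleftrightarrow> t - z \<in> closure K" for z
    unfolding closure_dual mem_dual by auto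
  have "D.exposed a (uminus ` B) (uminus ` R) (- q - t) \<longleftrightarrow>
    (\<exists>z. t - (z - (- q - t)) \<in> K \<and> (\<forall>b\<in>B. t - (z - zoom a (- b)) \<notin> closure K) \<and>
      (\<forall>i\<in>R. t - (z - zoom a (- i) + t) \<notin> closure K))"
    unfolding D.exposed_def m by simp
  also have "\<dots> \<longleftrightarrow> (\<exists>z. - z - q \<in> K \<and> (\<forall>b\<in>B. - z - zoom a b + t \<notin> closure K) \<and> (\<forall>i\<in>R. - z - zoom a i \<notin> closure K))"
    by (simp add: zoom_minus algebra_simps)
  also have "\<dots> \<longleftrightarrow> exposed a R B q"
    unfolding exposed_def
    by (rule ex_minus[of "\<lambda>z. z - q \<in> K \<and> (\<forall>b\<in>B. z - zoom a b + t \<notin> closure K) \<and> (\<forall>i\<in>R. z - zoom a i \<notin> closure K)", THEN trans]) blast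
  finally show ?thesis .
qed

lemma lower:
  assumes fin: "finite R" "finite B" "finite V" and sp: "spread \<alpha> \<beta> B" and ap: "apart (-\<beta>) \<alpha> B R"
  shows "eventually (\<lambda>a. \<forall>q. snd t - a\<^sup>2 * M \<le> - snd q \<longrightarrow>
     exposed a R B q \<or> (\<exists>b\<in>B. \<forall>v\<in>V. elevation (-\<beta>) b v < 0 \<longrightarrow> zoom a v - q \<in> K)) (at_right 0)"
proof -
  interpret D: lens "(-) t ` K" t \<beta> \<alpha> by (rule dual)
  have "apart \<beta> (- \<alpha>) (uminus ` B) (uminus ` R)" using apart_minus[OF ap] pos by simp
  from D.upper[OF _ _ _ spread_minus[OF sp] this, of "uminus ` V" M]
  have "eventually (\<lambda>a. \<forall>q. - a\<^sup>2 * M \<le> snd q \<longrightarrow>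
     D.exposed a (uminus ` B) (uminus ` R) q \<or> (\<exists>i\<in>uminus ` B. \<forall>v\<in>uminus ` V. 0 < elevation \<beta> i v \<longrightarrow> zoom a v - q \<in> (-) t ` K)) (at_right 0)"
    using fin by simp
  then show ?thesis
  proof eventually_elim
    case (elim a)
    show ?case
    proof (intro allI impI)
      fix q :: "real \<times> real" assume "snd t - a\<^sup>2 * M \<le> - snd q"
      then have "- a\<^sup>2 * M \<le> snd (- q - t)" by simp
      with elim have "D.exposed a (uminus ` B) (uminus ` R) (- q - t) \<or>
        (\<exists>i\<in>uminus ` B. \<forall>v\<in>uminus ` V. 0 < elevation \<beta> i v \<longrightarrow> zoom a v - (- q - t) \<in> (-) t ` K)" by blast
      then show "exposed a R B q \<or> (\<exists>b\<in>B. \<forall>v\<in>V. elevation (-\<beta>) b v < 0 \<longrightarrow> zoom a v - q \<in> K)"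
        unfolding exposed_dual mem_dual by (simp add: zoom_minus)
    qed
  qed
qed

section \<open>Unsplittable families of translations\<close>

lemma infinite_filler_if_exposed:
  assumes fin: "finite R" "finite B" and "exposed a R B q"
  shows "infinite {z. (\<forall>i\<in>R. z - zoom a i \<notin> K) \<and> (\<forall>b\<in>B. z - zoom a b + t \<notin> K) \<and> z - q \<in> K}"
proof -
  define U where "U = {z. z - q \<in> K} \<inter> (\<Inter>i\<in>R. {z. z - zoom a i \<in> - closure K}) \<inter> (\<Inter>b\<in>B. {z. z - zoom a b + t \<in> - closure K})"
  have "open U" unfolding U_def
    by (intro open_Int open_INT fin ballI open_vimage[unfolded vimage_def] openK continuous_intros open_Compl closed_closure)
  moreover have "U \<noteq> {}" using assms(3) unfolding exposed_def U_def by auto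
  ultimately have "infinite U" using finite_imp_not_open by blast
  moreover have "U \<subseteq> {z. (\<forall>i\<in>R. z - zoom a i \<notin> K) \<and> (\<forall>b\<in>B. z - zoom a b + t \<notin> K) \<and> z - q \<in> K}"
    unfolding U_def using closure_subset[of K] by auto
  ultimately show ?thesis by (rule infinite_super[rotated])
qed

text \<open>The set \<open>W\<close> consists of the zoomed vertices and of the filler \<open>X\<close> of all points outside the edges. No edge contains
a filler point, so the colouring property of the configuration is unaffected.\<close>
lemma unsplittable_translations:
  obtains W where "\<forall>q. infinite {w\<in>W. w - q \<in> K} \<or> m \<le> card {w\<in>W. w - q \<in> K}"
    "\<forall>S. \<exists>q. (\<forall>w\<in>W. w - q \<in> K \<longrightarrow> w \<in> S) \<or> (\<forall>w\<in>W. w - q \<in> K \<longrightarrow> w \<notin> S)"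
proof -
  obtain V R B where conf: "config \<alpha> \<beta> m m V R B" using config_exists[OF pos] by blast
  note fin = configD(1-3)[OF conf]
  have id: "filterlim (\<lambda>a::real. a) (at_right 0) (at_right 0)" by (rule filterlim_ident)
  obtain M where M: "eventually (\<lambda>a. \<forall>q. a\<^sup>2 * M \<le> - snd q \<and> - snd q \<le> snd t - a\<^sup>2 * M \<longrightarrow> exposed a R B q) (at_right 0)"
    using middle[OF fin(2,3)] by blast
  note up = upper[OF fin(2,3,1) configD(4)[OF conf] configD(6)[OF conf], of M]
  note lo = lower[OF fin(2,3,1) configD(5)[OF conf] configD(7)[OF conf], of M]
  have red: "eventually (\<lambda>a. \<forall>i\<in>R. \<forall>v\<in>V. elevation \<alpha> i v < 0 \<longrightarrow> zoom a v - zoom a i \<notin> K) (at_right 0)"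
  proof (intro eventually_ball_finite fin ballI)
    fix i v
    show "eventually (\<lambda>a. elevation \<alpha> i v < 0 \<longrightarrow> zoom a v - zoom a i \<notin> K) (at_right 0)"
    proof (cases "elevation \<alpha> i v < 0")
      case True
      then have "eventually (\<lambda>a. zoom a (v - i) \<notin> closure K) (at_right 0)"
        by (intro bottom_outside[OF id tendsto_const]) simp
      then show ?thesis by (rule eventually_mono) (use closure_subset in \<open>auto simp: zoom_diff\<close>)
    qed simp
  qed
  have blue: "eventually (\<lambda>a. \<forall>b\<in>B. \<forall>v\<in>V. 0 < elevation (-\<beta>) b v \<longrightarrow> zoom a v - zoom a b + t \<notin> K) (at_right 0)"
  proof (intro eventually_ball_finite fin ballI)
    fix b v
    show "eventually (\<lambda>a. 0 < elevation (-\<beta>) b v \<longrightarrow> zoom a v - zoom a b + t \<notin> K) (at_right 0)"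
    proof (cases "0 < elevation (-\<beta>) b v")
      case True
      then have "eventually (\<lambda>a. t + zoom a (v - b) \<notin> closure K) (at_right 0)"
        by (intro top_outside[OF id tendsto_const]) simp
      then show ?thesis by (rule eventually_mono) (use closure_subset in \<open>auto simp: zoom_diff add.commute\<close>)
    qed simp
  qed
  obtain a where a: "0 < a"
    and mid: "\<forall>q. a\<^sup>2 * M \<le> - snd q \<and> - snd q \<le> snd t - a\<^sup>2 * M \<longrightarrow> exposed a R B q"
    and up: "\<forall>q. - a\<^sup>2 * M \<le> snd q \<longrightarrow> exposed a R B q \<or> (\<exists>i\<in>R. \<forall>v\<in>V. 0 < elevation \<alpha> i v \<longrightarrow> zoom a v - q \<in> K)"
    and lo: "\<forall>q. snd t - a\<^sup>2 * M \<le> - snd q \<longrightarrow> exposed a R B q \<or> (\<exists>b\<in>B. \<forall>v\<in>V. elevation (-\<beta>) b v < 0 \<longrightarrow> zoom a v - q \<in> K)"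
    and red: "\<forall>i\<in>R. \<forall>v\<in>V. elevation \<alpha> i v < 0 \<longrightarrow> zoom a v - zoom a i \<notin> K"
    and blue: "\<forall>b\<in>B. \<forall>v\<in>V. 0 < elevation (-\<beta>) b v \<longrightarrow> zoom a v - zoom a b + t \<notin> K"
    using eventually_happens'[OF trivial_limit_at_right_real
        eventually_conj[OF eventually_at_right_pos eventually_conj[OF M eventually_conj[OF up eventually_conj[OF lo eventually_conj[OF red blue]]]]]]
    by (elim exE conjE) (rule that; assumption)
  define X where "X = {z. (\<forall>i\<in>R. z - zoom a i \<notin> K) \<and> (\<forall>b\<in>B. z - zoom a b + t \<notin> K)}"
  define W where "W = zoom a ` V \<union> X"
  have inj: "inj_on (zoom a) T" for T using zoom_inj[of a] a by (auto simp: inj_on_def inj_def)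
  have traces: "infinite {w\<in>W. w - q \<in> K} \<or> m \<le> card {w\<in>W. w - q \<in> K}"
    if T: "T \<subseteq> V" "m \<le> card T" "\<And>v. v \<in> T \<Longrightarrow> zoom a v - q \<in> K" for T q
  proof -
    have "zoom a ` T \<subseteq> {w\<in>W. w - q \<in> K}" using T unfolding W_def by auto
    moreover have "m \<le> card (zoom a ` T)" using T(2) by (simp add: card_image inj)
    ultimately show ?thesis using card_mono order_trans by blast
  qed
  have exp: "infinite {w\<in>W. w - q \<in> K}" if "exposed a R B q" for q
    by (rule infinite_super[OF _ infinite_filler_if_exposed[OF fin(2,3) that]]) (auto simp: W_def X_def)
  show thesis
  proof (rule that; intro allI)
    fix q :: "real \<times> real"
    consider "- a\<^sup>2 * M \<le> snd q" | "snd t - a\<^sup>2 * M \<le> - snd q"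
      | "a\<^sup>2 * M \<le> - snd q" "- snd q \<le> snd t - a\<^sup>2 * M" by (simp add: not_le) linarith
    then show "infinite {w\<in>W. w - q \<in> K} \<or> m \<le> card {w\<in>W. w - q \<in> K}"
    proof cases
      case 1
      from up[rule_format, OF this] show ?thesis
      proof (elim disjE bexE)
        fix i assume "i \<in> R" "\<forall>v\<in>V. 0 < elevation \<alpha> i v \<longrightarrow> zoom a v - q \<in> K"
        then show ?thesis using configD(10)[OF conf] by (intro traces[of "{v\<in>V. 0 < elevation \<alpha> i v}"]) auto
      qed (use exp in blast)
    next
      case 2
      from lo[rule_format, OF this] show ?thesis
      proof (elim disjE bexE)
        fix b assume "b \<in> B" "\<forall>v\<in>V. elevation (-\<beta>) b v < 0 \<longrightarrow> zoom a v - q \<in> K"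
        then show ?thesis using configD(11)[OF conf] by (intro traces[of "{v\<in>V. elevation (-\<beta>) b v < 0}"]) auto
      qed (use exp in blast)
    next
      case 3
      then show ?thesis using exp mid by blast
    qed
  next
    fix S
    have r: "0 < elevation \<alpha> i v" if "i \<in> R" "v \<in> V" "zoom a v - zoom a i \<in> K" for i v
      using red configD(8)[OF conf] that by (meson linorder_neqE)
    have b: "elevation (-\<beta>) b v < 0" if "b \<in> B" "v \<in> V" "zoom a v - (zoom a b - t) \<in> K" for b v
    proof -
      have "zoom a v - zoom a b + t \<in> K" using that(3) by (simp add: algebra_simps)
      then show ?thesis using blue configD(9)[OF conf] that(1,2) by (meson linorder_neqE)
    qed
    from configD(12)[OF conf, of "zoom a -` S"]
    show "\<exists>q. (\<forall>w\<in>W. w - q \<in> K \<longrightarrow> w \<in> S) \<or> (\<forall>w\<in>W. w - q \<in> K \<longrightarrow> w \<notin> S)"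
    proof (elim disjE bexE)
      fix i assume i: "i \<in> R" "\<forall>v\<in>V. 0 < elevation \<alpha> i v \<longrightarrow> v \<in> zoom a -` S"
      have "w \<in> S" if w: "w \<in> W" "w - zoom a i \<in> K" for w
      proof -
        have "w \<notin> X" using w(2) i(1) unfolding X_def by auto
        then obtain v where v: "v \<in> V" "w = zoom a v" using w(1) unfolding W_def by blast
        then show ?thesis using i r[OF i(1) v(1)] w(2) by blast
      qed
      then show ?thesis by blast
    next
      fix c assume c: "c \<in> B" "\<forall>v\<in>V. elevation (-\<beta>) c v < 0 \<longrightarrow> v \<notin> zoom a -` S"
      have "w \<notin> S" if w: "w \<in> W" "w - (zoom a c - t) \<in> K" for w
      proof -
        have "w - zoom a c + t \<in> K" using w(2) by (simp add: algebra_simps)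
        then have "w \<notin> X" using c(1) unfolding X_def by blast
        then obtain v where v: "v \<in> V" "w = zoom a v" using w(1) unfolding W_def by blast
        then show ?thesis using c b[OF c(1) v(1)] w(2) by blast
      qed
      then show ?thesis by blast
    qed
  qed
qed

end

section \<open>Translates of the original set\<close>

text \<open>Distinct translation vectors must give distinct translates, since coverings are sets of sets. A
period would move the origin to a second point of the closure on the x-axis.\<close>
lemma (in lens) translation_free:
  assumes "\<And>k. k \<in> K \<longleftrightarrow> d + k \<in> K"
  shows "d = 0"
proof -
  have 0: "0 \<in> closure K" using bottom unfolding touches_def frontier_def by auto
  have eq: "(+) d ` K = K"
  proof (intro equalityI subsetI)
    fix x assume "x \<in> K"
    then have "x - d \<in> K" using assms[of "x - d"] by simp
    then have "d + (x - d) \<in> (+) d ` K" by (rule imageI)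
    then show "x \<in> (+) d ` K" by simp
  qed (use assms in auto)
  have cl: "(+) d ` closure K = closure K" using closure_translation[of d K] unfolding eq by simp
  have d: "d \<in> closure K" using imageI[OF 0, of "(+) d"] by (simp only: cl add_0_right)
  have "0 \<in> (+) d ` closure K" using 0 by (simp only: cl)
  then obtain x where x: "x \<in> closure K" "d + x = 0" by (elim imageE) simp
  have "snd d + snd x = 0" using x(2) by (metis snd_add snd_zero)
  then have sd: "snd d = 0" using closure_bounds(1)[OF d] closure_bounds(1)[OF x(1)] by linarith
  obtain N where N: "0 < N" "eventually (\<lambda>a. \<forall>v\<in>closure K. snd v \<le> a\<^sup>2 * 0 \<longrightarrow> \<bar>fst v\<bar> \<le> a * N) (at_right 0)"
    by (rule touches_narrow[OF bottom pos(1)])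
  have "eventually (\<lambda>a. \<bar>fst d\<bar> \<le> a * N) (at_right 0)"
    using N(2) by (rule eventually_mono) (use d sd in auto)
  moreover have "((\<lambda>a. a * N) \<longlongrightarrow> 0) (at_right 0)" by (auto intro!: tendsto_eq_intros)
  ultimately have "\<bar>fst d\<bar> \<le> 0" by (intro tendsto_lowerbound) (auto simp: trivial_limit_at_right_real)
  with sd show ?thesis by (simp add: prod_eq_iff)
qed

lemma orthonormal_expansion:
  fixes e n x :: "real^2"
  assumes "norm e = 1" "norm n = 1" "e \<bullet> n = 0"
  shows "x = (e \<bullet> x) *\<^sub>R e + (n \<bullet> x) *\<^sub>R n"
proof -
  have ne: "e \<noteq> n" using assms by (metis inner_eq_zero_iff norm_zero zero_neq_one)
  have po: "pairwise orthogonal {e, n}" using assms by (simp add: pairwise_def orthogonal_def inner_commute)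
  have "e \<noteq> 0" "n \<noteq> 0" using assms by auto
  then have "independent {e, n}" using po by (intro pairwise_orthogonal_independent) auto
  then have "UNIV \<subseteq> span {e, n}" using ne
    by (intro card_ge_dim_independent) simp_all
  then have "(\<Sum>b\<in>{e, n}. (x \<bullet> b) *\<^sub>R b) = x"
    using po assms by (intro orthonormal_basis_expand) auto
  then show ?thesis using ne by (simp add: inner_commute)
qed

text \<open>The chart is an isometry onto the coordinate plane, so closure, frontier and distances carry over.\<close>
lemma touches_chart:
  fixes C :: "(real^2) set"
  assumes C: "open C" "convex C" and en: "norm e = 1" "norm n = 1" "e \<bullet> n = 0"
    and p: "p \<in> frontier C" "C \<subseteq> {x. 0 < n \<bullet> (x - p)}"
    and curv: "\<forall>\<delta>>0. \<exists>\<epsilon>>0. \<forall>q \<in> frontier C \<inter> ball p \<epsilon>.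
           (1 - \<delta>) * r * (e \<bullet> (q - p))\<^sup>2 \<le> n \<bullet> (q - p) \<and> n \<bullet> (q - p) \<le> (1 + \<delta>) * r * (e \<bullet> (q - p))\<^sup>2"
  shows "touches ((\<lambda>x. (e \<bullet> (x - p), n \<bullet> (x - p))) ` C) r"
proof -
  define L where "L = (\<lambda>x. (e \<bullet> x, n \<bullet> x))"
  have ex: "x = (e \<bullet> x) *\<^sub>R e + (n \<bullet> x) *\<^sub>R n" for x :: "real^2" by (rule orthonormal_expansion[OF en])
  have lin: "linear L" unfolding L_def by (intro linearI) (simp_all add: inner_add_right)
  have inj: "inj L"
    by (rule inj_on_inverseI[of _ "\<lambda>v. fst v *\<^sub>R e + snd v *\<^sub>R n"]) (simp add: L_def ex[symmetric])
  have surj: "surj L"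
  proof (rule surjI)
    fix v
    show "L (fst v *\<^sub>R e + snd v *\<^sub>R n) = v"
      using en unfolding L_def by (simp add: inner_add_right inner_commute[of n e] prod_eq_iff power2_norm_eq_inner[symmetric])
  qed
  have nrm: "norm (L x) = norm x" for x
  proof -
    have "(norm x)\<^sup>2 = x \<bullet> x" by (rule power2_norm_eq_inner)
    also have "\<dots> = ((e \<bullet> x) *\<^sub>R e + (n \<bullet> x) *\<^sub>R n) \<bullet> x" using ex[of x] by simp
    also have "\<dots> = (e \<bullet> x)\<^sup>2 + (n \<bullet> x)\<^sup>2" by (simp add: inner_add_left power2_eq_square)
    finally have "norm x = sqrt ((e \<bullet> x)\<^sup>2 + (n \<bullet> x)\<^sup>2)" by (metis norm_ge_zero real_sqrt_unique)
    then show ?thesis by (simp add: L_def norm_prod_def)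
  qed
  define D where "D = (\<lambda>x. - p + x) ` C"
  define K where "K = L ` D"
  have K: "K = (\<lambda>x. (e \<bullet> (x - p), n \<bullet> (x - p))) ` C" by (simp add: K_def D_def L_def image_image)
  have oD: "open D" unfolding D_def by (rule open_translation[OF C(1)])
  have cD: "convex D" unfolding D_def by (rule convex_translation[OF C(2)])
  have fD: "frontier D = (\<lambda>x. - p + x) ` frontier C" unfolding D_def by (rule frontier_translation)
  have oK: "open K" unfolding K_def by (rule open_surjective_linear_image[OF oD lin surj])
  have fK: "frontier K = L ` frontier D"
  proof -
    have "closure K = L ` closure D" unfolding K_def by (rule closure_injective_linear_image[OF lin inj, symmetric])
    then show ?thesis unfolding frontier_def interior_open[OF oK] interior_open[OF oD] unfolding K_def
      by (simp add: image_set_diff[OF inj])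
  qed
  show ?thesis unfolding touches_def K[symmetric]
  proof (intro conjI allI impI)
    show "open K" by fact
    show "convex K" unfolding K_def by (rule convex_linear_image[OF lin cD])
    show "K \<subseteq> {v. 0 < snd v}" using p(2) unfolding K by auto
    show "0 \<in> frontier K" using p(1) unfolding fK fD by (force simp: L_def zero_prod_def)
    fix \<delta> :: real assume "0 < \<delta>"
    with curv obtain \<epsilon> where \<epsilon>: "0 < \<epsilon>" "\<forall>q \<in> frontier C \<inter> ball p \<epsilon>.
           (1 - \<delta>) * r * (e \<bullet> (q - p))\<^sup>2 \<le> n \<bullet> (q - p) \<and> n \<bullet> (q - p) \<le> (1 + \<delta>) * r * (e \<bullet> (q - p))\<^sup>2" by blast
    show "\<exists>\<rho>>0. \<forall>z\<in>frontier K \<inter> ball 0 \<rho>. (1 - \<delta>) * r * (fst z)\<^sup>2 \<le> snd z \<and> snd z \<le> (1 + \<delta>) * r * (fst z)\<^sup>2"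
    proof (rule exI[of _ \<epsilon>], intro conjI ballI)
      show "0 < \<epsilon>" by (rule \<epsilon>(1))
    next
      fix z assume z: "z \<in> frontier K \<inter> ball 0 \<epsilon>"
      then obtain q where q: "q \<in> frontier C" "z = L (q - p)" unfolding fK fD by auto
      have "norm (q - p) < \<epsilon>" using z q(2) by (simp add: nrm)
      then have "q \<in> frontier C \<inter> ball p \<epsilon>" using q(1) by (simp add: dist_norm norm_minus_commute)
      from bspec[OF \<epsilon>(2) this]
      show "(1 - \<delta>) * r * (fst z)\<^sup>2 \<le> snd z" "snd z \<le> (1 + \<delta>) * r * (fst z)\<^sup>2"
        unfolding q(2) L_def by simp_all
    qed
  qed
qed

text \<open>Parallel lines have opposite inner normals here: with equal normals each point of tangency would lie on the
inner side of the other line or on it, so the lines would coincide. Tangent vectors may differ in sign, which the squared abscissa does not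
see.\<close>
lemma lens_of_supporting_lines:
  fixes C :: "(real^2) set"
  assumes C: "open C" "convex C" and parallel: "has_parallel_supporting_lines_with_positive_curvature C"
  obtains e n p t \<alpha> \<beta> where "norm e = 1" "norm n = 1" "e \<bullet> n = 0"
    "lens ((\<lambda>x. (e \<bullet> (x - p), n \<bullet> (x - p))) ` C) t \<alpha> \<beta>"
proof -
  obtain L1 L2 p p' where parallel: "affine_parallel L1 L2" "L1 \<noteq> L2"
    and c: "positive_curvature_at C L1 p" "positive_curvature_at C L2 p'"
    using parallel unfolding has_parallel_supporting_lines_with_positive_curvature_def by blast
  obtain e n \<alpha> where 1: "p \<in> frontier C" "norm e = 1" "norm n = 1" "e \<bullet> n = 0" "L1 = {x. n \<bullet> (x - p) = 0}"
    "C \<subseteq> {x. n \<bullet> (x - p) > 0}" "0 < \<alpha>" and curv1: "\<forall>\<delta>>0. \<exists>\<epsilon>>0. \<forall>q \<in> frontier C \<inter> ball p \<epsilon>.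
           (1 - \<delta>) * \<alpha> * (e \<bullet> (q - p))\<^sup>2 \<le> n \<bullet> (q - p) \<and> n \<bullet> (q - p) \<le> (1 + \<delta>) * \<alpha> * (e \<bullet> (q - p))\<^sup>2"
    using c(1) unfolding positive_curvature_at_def by blast
  obtain e' n' \<beta> where 2: "p' \<in> frontier C" "norm e' = 1" "norm n' = 1" "e' \<bullet> n' = 0" "L2 = {x. n' \<bullet> (x - p') = 0}"
    "C \<subseteq> {x. n' \<bullet> (x - p') > 0}" "0 < \<beta>" and curv2: "\<forall>\<delta>>0. \<exists>\<epsilon>>0. \<forall>q \<in> frontier C \<inter> ball p' \<epsilon>.
           (1 - \<delta>) * \<beta> * (e' \<bullet> (q - p'))\<^sup>2 \<le> n' \<bullet> (q - p') \<and> n' \<bullet> (q - p') \<le> (1 + \<delta>) * \<beta> * (e' \<bullet> (q - p'))\<^sup>2"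
    using c(2) unfolding positive_curvature_at_def by blast
  note ex = orthonormal_expansion[OF 1(2-4)]
  obtain a where a: "L2 = (\<lambda>x. a + x) ` L1" using parallel(1) unfolding affine_parallel_def by blast
  have "a + p \<in> L2" "a + (p + e) \<in> L2" unfolding a 1(5) using 1(4) by (auto simp: inner_commute)
  then have "n' \<bullet> (a + p - p') = 0" "n' \<bullet> (a + (p + e) - p') = 0" unfolding 2(5) by auto
  then have n'e: "e \<bullet> n' = 0" by (simp add: inner_diff_right inner_add_right inner_commute)
  obtain d where n': "n' = d *\<^sub>R n" using ex[of n'] n'e by (metis add_0_left scaleR_zero_left)
  then have "\<bar>d\<bar> = 1" using 1(3) 2(3) by simp
  moreover have "d \<noteq> 1"
  proof
    assume "d = 1"
    then have nn: "n' = n" using n' by simp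
    have cl: "closure C \<subseteq> {x. 0 \<le> n \<bullet> (x - y)}" if "C \<subseteq> {x. n \<bullet> (x - y) > 0}" for y
    proof (rule closure_minimal)
      show "closed {x. 0 \<le> n \<bullet> (x - y)}" by (intro closed_Collect_le continuous_intros)
    qed (use that in auto)
    have "p \<in> closure C" "p' \<in> closure C" using 1(1) 2(1) unfolding frontier_def by auto
    then have "0 \<le> n \<bullet> (p - p')" "0 \<le> n \<bullet> (p' - p)" using cl[OF 1(6)] cl[of p'] 2(6) unfolding nn by auto
    then have "n \<bullet> p = n \<bullet> p'" by (simp add: inner_diff_right)
    then have "L1 = L2" unfolding 1(5) 2(5) nn by (simp add: inner_diff_right)
    with parallel(2) show False by simp
  qed
  ultimately have d: "d = -1" by linarith
  have nm: "n' = - n" using n' d by simp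
  have "n \<bullet> e' = 0" using 2(4) unfolding nm by (simp add: inner_commute)
  then obtain c where e': "e' = c *\<^sub>R e" using ex[of e'] by (metis add_0_right scaleR_zero_left)
  then have "\<bar>c\<bar> = 1" using 1(2) 2(2) by simp
  then have "c = 1 \<or> c = -1" by linarith
  then have "e' = e \<or> e' = - e" using e' by auto
  then have sq: "(e' \<bullet> y)\<^sup>2 = (- e \<bullet> y)\<^sup>2" for y by auto
  have t1: "touches ((\<lambda>x. (e \<bullet> (x - p), n \<bullet> (x - p))) ` C) \<alpha>"
    by (rule touches_chart[OF C 1(2-4,1,6) curv1])
  have t2: "touches ((\<lambda>x. (- e \<bullet> (x - p'), - n \<bullet> (x - p'))) ` C) \<beta>"
    by (rule touches_chart[OF C _ _ _ 2(1)]) (use 1 2(6) curv2 in \<open>simp_all only: nm sq norm_minus_cancel inner_minus_left inner_minus_right neg_equal_0_iff_equal minus_zero\<close>)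
  define t where "t = (e \<bullet> (p' - p), n \<bullet> (p' - p))"
  have "(-) t ` (\<lambda>x. (e \<bullet> (x - p), n \<bullet> (x - p))) ` C = (\<lambda>x. (- e \<bullet> (x - p'), - n \<bullet> (x - p'))) ` C"
    by (simp add: image_image t_def inner_diff_right algebra_simps)
  with t1 t2 1(7) 2(7) have "lens ((\<lambda>x. (e \<bullet> (x - p), n \<bullet> (x - p))) ` C) t \<alpha> \<beta>"
    unfolding lens_def by simp
  then show thesis using that 1(2-4) by blast
qed

text \<open>The point \<open>x\<close> is covered by the translate with index \<open>w\<close> iff \<open>w + g x \<in> K\<close>, where \<open>g\<close> is the chart; so
\<open>x\<close> plays the role of the translate of \<open>K\<close> by \<open>- g x\<close>.\<close>
theorem theorem3:
  fixes C :: "(real^2) set" and m :: nat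
  assumes "open C" and "convex C"
    and "has_parallel_supporting_lines_with_positive_curvature C"
    and "m > 0"
  shows "\<exists>F. F \<subseteq> translates C \<and> m_fold_covering m F UNIV \<and>
             \<not> splits_into_two_coverings F UNIV"
proof -
  obtain e n p t \<alpha> \<beta> where en: "norm e = 1" "norm n = 1" "e \<bullet> n = 0"
    and lens: "lens ((\<lambda>x. (e \<bullet> (x - p), n \<bullet> (x - p))) ` C) t \<alpha> \<beta>"
    by (rule lens_of_supporting_lines[OF assms(1-3)])
  note ex = orthonormal_expansion[OF en]
  define g where "g = (\<lambda>x. (e \<bullet> (x - p), n \<bullet> (x - p)))"
  define K where "K = g ` C"
  interpret lens K t \<alpha> \<beta> using lens unfolding K_def g_def .
  define \<psi> where "\<psi> = (\<lambda>v::real\<times>real. fst v *\<^sub>R e + snd v *\<^sub>R n)"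
  have e\<psi>: "e \<bullet> \<psi> v = fst v" "n \<bullet> \<psi> v = snd v" for v
    using en unfolding \<psi>_def by (simp_all add: inner_add_right inner_commute[of n e] power2_norm_eq_inner[symmetric])
  have g\<psi>: "g (x + \<psi> v) = v + g x" for x v
    by (simp add: g_def prod_eq_iff e\<psi> inner_diff_right inner_add_right)
  have "inj g"
    by (rule inj_on_inverseI[of _ "\<lambda>v. fst v *\<^sub>R e + snd v *\<^sub>R n + p"]) (simp add: g_def ex[symmetric])
  then have gK: "g x \<in> K \<longleftrightarrow> x \<in> C" for x unfolding K_def by (rule inj_image_mem_iff)
  define \<phi> where "\<phi> = (\<lambda>w. (+) (- \<psi> w) ` C)"
  have mem: "x \<in> \<phi> w \<longleftrightarrow> w - (- g x) \<in> K" for x w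
  proof -
    have "x \<in> \<phi> w \<longleftrightarrow> x + \<psi> w \<in> C"
    proof
      assume "x + \<psi> w \<in> C"
      then have "- \<psi> w + (x + \<psi> w) \<in> \<phi> w" unfolding \<phi>_def by (rule imageI)
      then show "x \<in> \<phi> w" by simp
    qed (auto simp: \<phi>_def)
    then show ?thesis unfolding gK[symmetric] g\<psi> by simp
  qed
  have surj: "\<exists>x. g x = v" for v
    using g\<psi>[of p v] by (intro exI[of _ "p + \<psi> v"]) (simp add: g_def zero_prod_def[symmetric])
  have inj: "inj \<phi>"
  proof (rule injI)
    fix w w' assume eq: "\<phi> w = \<phi> w'"
    have "k \<in> K \<longleftrightarrow> (w' - w) + k \<in> K" for k
    proof -
      obtain x where x: "g x = k - w" using surj by blast
      have "x \<in> \<phi> w \<longleftrightarrow> x \<in> \<phi> w'" using eq by simp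
      then show ?thesis unfolding mem x by (simp add: algebra_simps)
    qed
    then have "w' - w = 0" by (rule translation_free)
    then show "w = w'" by simp
  qed
  obtain W where W: "\<forall>q. infinite {w\<in>W. w - q \<in> K} \<or> m \<le> card {w\<in>W. w - q \<in> K}"
    "\<forall>S. \<exists>q. (\<forall>w\<in>W. w - q \<in> K \<longrightarrow> w \<in> S) \<or> (\<forall>w\<in>W. w - q \<in> K \<longrightarrow> w \<notin> S)"
    by (rule unsplittable_translations[of m])
  define F where "F = \<phi> ` W"
  have sub: "F \<subseteq> translates C" unfolding F_def \<phi>_def translates_def by blast
  have "infinite {S \<in> F. x \<in> S} \<or> m \<le> card {S \<in> F. x \<in> S}" for x
  proof -
    have eq: "{S \<in> F. x \<in> S} = \<phi> ` {w\<in>W. w - (- g x) \<in> K}" unfolding F_def mem[symmetric] by blast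
    have ij: "inj_on \<phi> T" for T using inj by (rule inj_on_subset) simp
    show ?thesis using W(1)[rule_format, of "- g x"] unfolding eq finite_image_iff[OF ij] card_image[OF ij] .
  qed
  then have cov: "m_fold_covering m F UNIV" unfolding m_fold_covering_def by blast
  have "\<not> splits_into_two_coverings F UNIV"
  proof
    assume "splits_into_two_coverings F UNIV"
    then obtain A B where AB: "A \<union> B = F" "A \<inter> B = {}" "covering A UNIV" "covering B UNIV"
      unfolding splits_into_two_coverings_def by blast
    have ne: "\<exists>S\<in>G. x \<in> S" if "covering G UNIV" for G :: "(real^2) set set" and x
    proof (rule ccontr)
      assume "\<not> (\<exists>S\<in>G. x \<in> S)"
      then have e: "{S \<in> G. x \<in> S} = {}" by blast
      have "infinite {S \<in> G. x \<in> S} \<or> 1 \<le> card {S \<in> G. x \<in> S}"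
        using that unfolding covering_def m_fold_covering_def by blast
      then show False unfolding e by simp
    qed
    obtain q where q: "(\<forall>w\<in>W. w - q \<in> K \<longrightarrow> w \<in> \<phi> -` A) \<or> (\<forall>w\<in>W. w - q \<in> K \<longrightarrow> w \<notin> \<phi> -` A)"
      using W(2) by blast
    obtain x where x: "g x = - q" using surj by blast
    have mem': "x \<in> \<phi> w \<longleftrightarrow> w - q \<in> K" for w unfolding mem x by simp
    from q show False
    proof
      assume *: "\<forall>w\<in>W. w - q \<in> K \<longrightarrow> w \<in> \<phi> -` A"
      obtain T where "T \<in> B" "x \<in> T" using ne[OF AB(4)] by blast
      moreover then obtain w where "w \<in> W" "T = \<phi> w" using AB(1) unfolding F_def by blast
      ultimately show False using * AB(2) mem' by auto
    next
      assume *: "\<forall>w\<in>W. w - q \<in> K \<longrightarrow> w \<notin> \<phi> -` A"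
      obtain T where "T \<in> A" "x \<in> T" using ne[OF AB(3)] by blast
      moreover then obtain w where "w \<in> W" "T = \<phi> w" using AB(1) unfolding F_def by blast
      ultimately show False using * mem' by auto
    qed
  qed
  with sub cov show ?thesis by blast
qed

end
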